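(* Single-sample OSO can yield unbounded benefits versus the myopic policy: for every $M>0$ there is an instance of the online resource allocation problem for which the expected total reward of the myopic policy is positive and the expected total reward of the single-sample OSO algorithm (run with an equivariant solver) is at least $M$ times the expected total reward of the myopic policy.
   Context: Online resource allocation problem. There are $m$ supply nodes ($j\in\mathcal{J}=\{1,\dots,m\}$) and $d$ resources ($k\in\mathcal{K}=\{1,\dots,d\}$); resource $k$ has deterministic capacity $b_k\ge 0$, and $b=(b_1,\dots,b_d)$. Items $t=1,\dots,T$ arrive one at a time. Item $t$ is described by $\xi^t=(r^t,A^t)$, where $r^t\in\mathbb{R}^m$ is a vector of rewards and $A^t\in\mathbb{R}_{\ge 0}^{m\times d}$ is a matrix of resource consumptions. The $\xi^1,\dots,\xi^T$ are i.i.d. from a known distribution $\mathcal{D}$ (with integrable rewards). Let $\Delta=\{x\in\{0,1\}^m:\sum_{j}x_j\le 1\}$. An instance consists of $T,m,d,b,\mathcal{D}$. An online algorithm chooses $\overline x^t\in\Delta$ irrevocably after observing $\xi^1,\dots,\xi^t$, subject to $\sum_{\tau\le t}(A^\tau)^\top\overline x^\tau\le b$; its total reward is $\sum_{t=1}^T r^t\cdot\overline x^t$. Single-sample OSO algorithm. For $t=1,\dots,T$: observe $\xi^t$; draw one fresh sample path $\widetilde\xi^{t+1}_t,\dots,\widetilde\xi^{T}_t$, with $\widetilde\xi^\tau_t=(\widetilde r^\tau_t,\widetilde A^\tau_t)$, i.i.d. from $\mathcal{D}$ and independent of everything else; use the solver to compute an optimal solution $(\widetilde x^t,\dots,\widetilde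 x^T)$ of $$\max\Big\{ r^t\cdot x^t+\sum_{\tau=t+1}^T \widetilde r^\tau_t\cdot x^\tau : \sum_{\tau=1}^{t-1}(A^\tau)^\top\overline x^\tau+(A^t)^\top x^t+\sum_{\tau=t+1}^T(\widetilde A^\tau_t)^\top x^\tau\le b,\; x^t,\dots,x^T\in\Delta\Big\};$$ implement $\overline x^t=\widetilde x^t$ and discard the rest. Equivariant solver. An exact solver for integer programs $\max\{\sum_{i=1}^s r^i\cdot x^i:\sum_{i=1}^s (A^i)^\top x^i\le b',\,x^i\in\Delta\}$ is equivariant if permuting the items permutes the solution in the same way: if it returns $(x^1,\dots,x^s)$ on the list of items $(r^1,A^1),\dots,(r^s,A^s)$, then for every permutation $\pi$ of $\{1,\dots,s\}$ it returns $(x^{\pi(1)},\dots,x^{\pi(s)})$ on the list $(r^{\pi(1)},A^{\pi(1)}),\dots,(r^{\pi(s)},A^{\pi(s)})$. The solver may use internal randomness (fresh and independent at each call, e.g. to break ties between identical items), in which case this is understood as equality in distribution. Myopic policy. At each $t$, implement an optimal solution $\overline x^t$ of $\max\{r^t\cdot x^t:\sum_{\tau=1}^{t-1}(A^\tau)^\top\overline x^\tau+(A^t)^\top x^t\le b,\ x^t\in\Delta\}$. *)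

theory Defs
  imports "HOL-Probability.Probability"
begin

text \<open>
  Supply nodes, resources and the positions in a list of items are indexed from 0, by
  \<open>{..<m}\<close>, \<open>{..<d}\<close> and \<open>{..<s}\<close>. Vectors, matrices and lists are extensional functions on these
  index sets (\<open>\<rightarrow>\<^sub>E\<close>).
\<close>

type_synonym item = "(nat \<Rightarrow> real) \<times> (nat \<Rightarrow> nat \<Rightarrow> real)"
type_synonym capacity = "nat \<Rightarrow> real"
type_synonym decision = "nat \<Rightarrow> real"

definition item_space :: "nat \<Rightarrow> nat \<Rightarrow> item measure" where
  "item_space m d =
     (\<Pi>\<^sub>M j\<in>{..<m}. borel) \<Otimes>\<^sub>M (\<Pi>\<^sub>M j\<in>{..<m}. \<Pi>\<^sub>M k\<in>{..<d}. restrict_space borel {0..})"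

definition capacity_space :: "nat \<Rightarrow> capacity measure" where
  "capacity_space d = (\<Pi>\<^sub>M k\<in>{..<d}. borel)"

definition allocation_instance :: "nat \<Rightarrow> nat \<Rightarrow> nat \<Rightarrow> capacity \<Rightarrow> item measure \<Rightarrow> bool" where
  "allocation_instance T m d b D \<longleftrightarrow>
     1 \<le> T \<and> 1 \<le> m \<and> 1 \<le> d \<and> b \<in> {..<d} \<rightarrow>\<^sub>E {0..} \<and>
     prob_space D \<and> sets D = sets (item_space m d) \<and>
     (\<forall>j<m. integrable D (\<lambda>\<xi>. fst \<xi> j))"

definition Delta :: "nat \<Rightarrow> decision set" where
  "Delta m = {x \<in> {..<m} \<rightarrow>\<^sub>E {0, 1}. (\<Sum>j<m. x j) \<le> 1}"

definition item_reward :: "nat \<Rightarrow> item \<Rightarrow> decision \<Rightarrow> real" where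
  "item_reward m \<xi> x = (\<Sum>j<m. fst \<xi> j * x j)"

definition item_consumption :: "nat \<Rightarrow> item \<Rightarrow> decision \<Rightarrow> nat \<Rightarrow> real" where
  "item_consumption m \<xi> x k = (\<Sum>j<m. snd \<xi> j k * x j)"


section \<open>Integer programs and solvers\<close>

definition ip_feasible ::
    "nat \<Rightarrow> nat \<Rightarrow> nat \<Rightarrow> capacity \<Rightarrow> (nat \<Rightarrow> item) \<Rightarrow> (nat \<Rightarrow> decision) set" where
  "ip_feasible m d s \<beta> I =
     {x \<in> {..<s} \<rightarrow>\<^sub>E Delta m. \<forall>k<d. (\<Sum>i<s. item_consumption m (I i) (x i) k) \<le> \<beta> k}"

definition ip_optimal ::
    "nat \<Rightarrow> nat \<Rightarrow> nat \<Rightarrow> capacity \<Rightarrow> (nat \<Rightarrow> item) \<Rightarrow> (nat \<Rightarrow> decision) set" where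
  "ip_optimal m d s \<beta> I =
     {x. is_arg_max (\<lambda>x. \<Sum>i<s. item_reward m (I i) (x i)) (\<lambda>x. x \<in> ip_feasible m d s \<beta> I) x}"

text \<open>
  A solver takes the number of items, the right-hand side and the list of items. It may be
  randomized, so it returns the distribution of its answer; a deterministic solver returns
  point masses. The distribution has to depend measurably on the data for the random run of an
  algorithm that calls the solver to be well defined. As consumptions are nonnegative, the
  program has a feasible solution if and only if the right-hand side is nonnegative; outside
  this case nothing (except measurability) is required of the answer.
\<close>

type_synonym solver = "nat \<Rightarrow> capacity \<Rightarrow> (nat \<Rightarrow> item) \<Rightarrow> (nat \<Rightarrow> decision) pmf"

definition exact_solver :: "nat \<Rightarrow> nat \<Rightarrow> solver \<Rightarrow> bool" where
  "exact_solver m d sol \<longleftrightarrow>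
     (\<forall>s. (\<lambda>(\<beta>, I). measure_pmf (sol s \<beta> I))
            \<in> capacity_space d \<Otimes>\<^sub>M (\<Pi>\<^sub>M i\<in>{..<s}. item_space m d)
              \<rightarrow>\<^sub>M subprob_algebra (count_space UNIV)) \<and>
     (\<forall>s. \<forall>\<beta> \<in> {..<d} \<rightarrow>\<^sub>E {0..}. \<forall>I \<in> {..<s} \<rightarrow>\<^sub>E space (item_space m d).
        set_pmf (sol s \<beta> I) \<subseteq> ip_optimal m d s \<beta> I)"

definition equivariant_solver :: "nat \<Rightarrow> nat \<Rightarrow> solver \<Rightarrow> bool" where
  "equivariant_solver m d sol \<longleftrightarrow>
     (\<forall>s. \<forall>\<beta> \<in> {..<d} \<rightarrow>\<^sub>E {0..}. \<forall>I \<in> {..<s} \<rightarrow>\<^sub>E space (item_space m d).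
        \<forall>\<pi>. \<pi> permutes {..<s} \<longrightarrow>
          sol s \<beta> (\<lambda>i\<in>{..<s}. I (\<pi> i)) = map_pmf (\<lambda>x. \<lambda>i\<in>{..<s}. x (\<pi> i)) (sol s \<beta> I))"


section \<open>Online policies\<close>

text \<open>
  A policy gives the distribution of the decision for the current item, as a function of the
  number \<open>n\<close> of items still to come after it, the residual capacity \<open>\<beta>\<close> (that is, \<open>b\<close> minus the
  consumption of the decisions already taken) and the current item.
\<close>

type_synonym policy = "nat \<Rightarrow> capacity \<Rightarrow> item \<Rightarrow> decision measure"

text \<open>
  \<open>run m d D p n \<beta> v\<close> is the distribution of the final total reward when \<open>n\<close> items remain to be
  observed, \<open>\<beta>\<close> is the residual capacity and \<open>v\<close> is the reward collected so far. Drawing the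
  current item from \<open>D\<close> at every step makes the items independent and identically distributed.
\<close>

primrec run ::
    "nat \<Rightarrow> nat \<Rightarrow> item measure \<Rightarrow> policy \<Rightarrow> nat \<Rightarrow> capacity \<Rightarrow> real \<Rightarrow> real measure" where
  "run m d D p 0 \<beta> v = return borel v"
| "run m d D p (Suc n) \<beta> v =
     D \<bind> (\<lambda>\<xi>. p n \<beta> \<xi> \<bind> (\<lambda>x.
       run m d D p n (\<lambda>k\<in>{..<d}. \<beta> k - item_consumption m \<xi> x k) (v + item_reward m \<xi> x)))"

definition expected_total_reward ::
    "nat \<Rightarrow> nat \<Rightarrow> nat \<Rightarrow> capacity \<Rightarrow> item measure \<Rightarrow> policy \<Rightarrow> real" where
  "expected_total_reward T m d b D p = (\<integral>v. v \<partial>run m d D p T b 0)"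

text \<open>
  The myopic policy implements an optimal solution of the program for the current item alone; a
  solver serves as its selection rule among the optimal solutions.
\<close>

definition myopic :: "solver \<Rightarrow> policy" where
  "myopic sol n \<beta> \<xi> = measure_pmf (map_pmf (\<lambda>x. x 0) (sol 1 \<beta> (\<lambda>i\<in>{..<1}. \<xi>)))"

text \<open>
  Single-sample OSO draws a fresh sample \<open>\<omega> 1, \<dots>, \<omega> n\<close> of the items still to come, has the program
  solved for the current item (at position 0) and the sampled ones, and implements only the part
  of the solution that concerns the current item.
\<close>

definition single_sample_oso :: "item measure \<Rightarrow> solver \<Rightarrow> policy" where
  "single_sample_oso D sol n \<beta> \<xi> =
     (\<Pi>\<^sub>M i\<in>{1..n}. D) \<bind> (\<lambda>\<omega>. measure_pmf (map_pmf (\<lambda>x. x 0) (sol (Suc n) \<beta> (fun_upd \<omega> 0 \<xi>))))"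


section \<open>Existence of exact equivariant solvers\<close>

lemma finite_Delta: "finite (Delta m)"
  by (rule finite_subset[of _ "{..<m} \<rightarrow>\<^sub>E {0, 1::real}"]) (auto simp: Delta_def intro!: finite_PiE)

lemma ip_feasible_subset: "ip_feasible m d s \<beta> I \<subseteq> {..<s} \<rightarrow>\<^sub>E Delta m"
  by (auto simp: ip_feasible_def)

lemma finite_ip_solutions: "finite ({..<s::nat} \<rightarrow>\<^sub>E Delta m)"
  by (intro finite_PiE) (auto simp: finite_Delta)

lemma ip_optimal_eq:
  "ip_optimal m d s \<beta> I = {x \<in> ip_feasible m d s \<beta> I. \<forall>y \<in> {..<s} \<rightarrow>\<^sub>E Delta m.
     y \<in> ip_feasible m d s \<beta> I \<longrightarrow>
       (\<Sum>i<s. item_reward m (I i) (y i)) \<le> (\<Sum>i<s. item_reward m (I i) (x i))}"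
  using ip_feasible_subset[of m d s \<beta> I]
  by (auto simp: ip_optimal_def is_arg_max_def not_less)

lemma ip_optimal_nonempty:
  assumes "\<beta> \<in> {..<d} \<rightarrow>\<^sub>E {0..}"
  shows "ip_optimal m d s \<beta> I \<noteq> {}"
proof -
  let ?F = "ip_feasible m d s \<beta> I" and ?f = "\<lambda>x. \<Sum>i<s. item_reward m (I i) (x i)"
  have fin: "finite ?F"
    using finite_subset[OF ip_feasible_subset finite_ip_solutions] .
  have "(\<lambda>i\<in>{..<s}. \<lambda>j\<in>{..<m}. 0) \<in> ?F"
    using assms by (auto simp: ip_feasible_def Delta_def item_consumption_def)
  then have ne: "?F \<noteq> {}" by blast
  have "Max (?f ` ?F) \<in> ?f ` ?F" using fin ne by (intro Max_in) auto
  then obtain x where x: "x \<in> ?F" "?f x = Max (?f ` ?F)" by (metis (no_types, lifting) imageE)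
  have "?f y \<le> ?f x" if "y \<in> ?F" for y
    unfolding x(2) using fin that by (intro Max_ge finite_imageI imageI)
  then have "is_arg_max ?f (\<lambda>x. x \<in> ?F) x"
    using x(1) unfolding is_arg_max_def by (meson not_less)
  then show ?thesis by (auto simp: ip_optimal_def)
qed

lemma component_measurable [measurable]:
  assumes "i < s" "j < m"
  shows "(\<lambda>I. fst (I i) j) \<in> borel_measurable (\<Pi>\<^sub>M i\<in>{..<s}. item_space m d)"
  using assms unfolding item_space_def by (measurable, auto)

lemma snd_component_measurable:
  assumes "j < m" "k < d"
  shows "(\<lambda>\<xi>. snd \<xi> j k) \<in> borel_measurable (item_space m d)"
proof -
  have 1: "(\<lambda>A. A j) \<in> (\<Pi>\<^sub>M j\<in>{..<m}. \<Pi>\<^sub>M k\<in>{..<d}. restrict_space borel {0::real..}) \<rightarrow>\<^sub>M (\<Pi>\<^sub>M k\<in>{..<d}. restrict_space borel {0::real..})"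
    using assms by (intro measurable_component_singleton) auto
  have 2: "(\<lambda>A. A k) \<in> (\<Pi>\<^sub>M k\<in>{..<d}. restrict_space borel {0::real..}) \<rightarrow>\<^sub>M restrict_space borel {0::real..}"
    using assms by (intro measurable_component_singleton) auto
  have "(\<lambda>\<xi>. snd \<xi> j k) \<in> item_space m d \<rightarrow>\<^sub>M restrict_space borel {0::real..}"
    unfolding item_space_def using measurable_compose[OF measurable_compose[OF measurable_snd 1] 2] .
  then show ?thesis by (auto simp: measurable_restrict_space2_iff)
qed

lemma component_measurable' [measurable]:
  assumes "i < s" "j < m" "k < d"
  shows "(\<lambda>I. snd (I i) j k) \<in> borel_measurable (\<Pi>\<^sub>M i\<in>{..<s}. item_space m d)"
  using measurable_compose[OF measurable_component_singleton[of i "{..<s}" "\<lambda>_. item_space m d"] snd_component_measurable[OF assms(2,3)]] assms(1)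
  by simp

lemma capacity_measurable [measurable]:
  "k < d \<Longrightarrow> (\<lambda>\<beta>. \<beta> k) \<in> borel_measurable (capacity_space d)"
  unfolding capacity_space_def by measurable

definition uniform_solver :: "nat \<Rightarrow> nat \<Rightarrow> solver" where
  "uniform_solver m d s \<beta> I =
     (if ip_optimal m d s \<beta> I = {} then return_pmf undefined else pmf_of_set (ip_optimal m d s \<beta> I))"

lemma uniform_solver_exact: "exact_solver m d (uniform_solver m d)"
  unfolding exact_solver_def
proof (intro conjI allI ballI)
  fix s and \<beta> :: capacity and I assume "\<beta> \<in> {..<d} \<rightarrow>\<^sub>E {0..}"
  then have "ip_optimal m d s \<beta> I \<noteq> {}" by (rule ip_optimal_nonempty)
  moreover have "finite (ip_optimal m d s \<beta> I)"
    by (rule finite_subset[OF _ finite_ip_solutions[of s m]]) (auto simp: ip_optimal_eq ip_feasible_def)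
  ultimately show "set_pmf (uniform_solver m d s \<beta> I) \<subseteq> ip_optimal m d s \<beta> I"
    by (simp add: uniform_solver_def)
next
  fix s :: nat
  let ?N = "capacity_space d \<Otimes>\<^sub>M (\<Pi>\<^sub>M i\<in>{..<s}. item_space m d)"
  let ?S = "{..<s} \<rightarrow>\<^sub>E Delta m"
  define h where "h X = measure_pmf (if X = {} then return_pmf undefined else pmf_of_set X)"
    for X :: "(nat \<Rightarrow> decision) set"
  have feas: "Measurable.pred ?N (\<lambda>(\<beta>, I). x \<in> ip_feasible m d s \<beta> I)" for x
    unfolding ip_feasible_def item_consumption_def mem_Collect_eq split_beta'
    by measurable
  have obj: "(\<lambda>w. \<Sum>i<s. item_reward m (snd w i) (x i)) \<in> borel_measurable ?N" for x
    unfolding item_reward_def by measurable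
  have pred: "Measurable.pred ?N (\<lambda>(\<beta>, I). x \<in> ip_optimal m d s \<beta> I)" for x
  proof -
    note feas[unfolded split_beta', measurable] obj[measurable]
    have "Measurable.pred ?N (\<lambda>w. \<forall>y\<in>?S. y \<in> ip_feasible m d s (fst w) (snd w) \<longrightarrow>
       (\<Sum>i<s. item_reward m (snd w i) (y i)) \<le> (\<Sum>i<s. item_reward m (snd w i) (x i)))"
      using finite_ip_solutions[of s m] by (intro pred_intros_finite(3)) measurable
    note [measurable] = this
    show ?thesis
      unfolding ip_optimal_eq mem_Collect_eq split_beta' by measurable
  qed
  have opt: "(\<lambda>(\<beta>, I). ip_optimal m d s \<beta> I) \<in> ?N \<rightarrow>\<^sub>M count_space (Pow ?S)"
  proof (subst measurable_count_space_eq2)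
    show "finite (Pow ?S)" using finite_ip_solutions by simp
    have "(\<lambda>(\<beta>, I). ip_optimal m d s \<beta> I) -` {X} \<inter> space ?N \<in> sets ?N" if "X \<in> Pow ?S" for X
    proof -
      have "Measurable.pred ?N (\<lambda>w. \<forall>x\<in>?S. (x \<in> ip_optimal m d s (fst w) (snd w)) \<longleftrightarrow> x \<in> X)"
        using finite_ip_solutions[of s m] pred[unfolded split_beta']
        by (intro pred_intros_finite(3)) (auto intro!: measurable)
      moreover have "(\<forall>x\<in>?S. (x \<in> ip_optimal m d s \<beta> I) \<longleftrightarrow> x \<in> X) \<longleftrightarrow> ip_optimal m d s \<beta> I = X"
        for \<beta> I
      proof -
        have "ip_optimal m d s \<beta> I \<subseteq> ?S" by (auto simp: ip_optimal_eq ip_feasible_def)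
        then show ?thesis using that by blast
      qed
      ultimately have "Measurable.pred ?N (\<lambda>w. ip_optimal m d s (fst w) (snd w) = X)" by simp
      then show ?thesis
        by (simp add: pred_def vimage_def Int_def split_beta' conj_commute)
    qed
    then show "(\<lambda>(\<beta>, I). ip_optimal m d s \<beta> I) \<in> space ?N \<rightarrow> Pow ?S \<and>
      (\<forall>X\<in>Pow ?S. (\<lambda>(\<beta>, I). ip_optimal m d s \<beta> I) -` {X} \<inter> space ?N \<in> sets ?N)"
      by (auto simp: ip_optimal_eq ip_feasible_def)
  qed
  have "h \<in> count_space (Pow ?S) \<rightarrow>\<^sub>M subprob_algebra (count_space UNIV)"
    by (auto simp: h_def measure_pmf_in_subprob_space)
  from measurable_compose[OF opt this]
  show "(\<lambda>(\<beta>, I). measure_pmf (uniform_solver m d s \<beta> I)) \<in> ?N \<rightarrow>\<^sub>M subprob_algebra (count_space UNIV)"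
    by (simp add: h_def uniform_solver_def split_beta')
qed

lemma uniform_solver_equivariant: "equivariant_solver m d (uniform_solver m d)"
  unfolding equivariant_solver_def
proof (intro allI ballI impI)
  fix s and \<beta> :: capacity and I and \<pi> :: "nat \<Rightarrow> nat"
  assume I: "I \<in> {..<s} \<rightarrow>\<^sub>E space (item_space m d)" and \<beta>: "\<beta> \<in> {..<d} \<rightarrow>\<^sub>E {0..}" and \<pi>: "\<pi> permutes {..<s}"
  let ?P = "\<lambda>\<pi> x. \<lambda>i\<in>{..<s}. x (\<pi> i)"
  have in_s: "\<sigma> i < s" if "\<sigma> permutes {..<s}" "i < s" for \<sigma> i
    using permutes_in_image[OF that(1), of i] that(2) by simp
  have feas: "?P \<sigma> x \<in> ip_feasible m d s \<beta> (?P \<sigma> I) \<and>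
      (\<Sum>i<s. item_reward m (?P \<sigma> I i) (?P \<sigma> x i)) = (\<Sum>i<s. item_reward m (I i) (x i))"
    if "\<sigma> permutes {..<s}" "x \<in> ip_feasible m d s \<beta> I" for \<sigma> I and x :: "nat \<Rightarrow> decision"
  proof -
    have *: "(\<Sum>i<s. g (?P \<sigma> I i) (?P \<sigma> x i)) = (\<Sum>i<s. g (I i) (x i))" for g :: "item \<Rightarrow> decision \<Rightarrow> real"
    proof -
      have "(\<Sum>i<s. g (?P \<sigma> I i) (?P \<sigma> x i)) = (\<Sum>i<s. ((\<lambda>i. g (I i) (x i)) \<circ> \<sigma>) i)"
        by (rule sum.cong) auto
      also have "\<dots> = (\<Sum>i<s. g (I i) (x i))"
        by (rule sum.permute[OF that(1), symmetric])
      finally show ?thesis .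
    qed
    have "?P \<sigma> x \<in> {..<s} \<rightarrow>\<^sub>E Delta m"
      using that(2) in_s[OF that(1)] by (auto simp: ip_feasible_def)
    then show ?thesis
      using that(2) *[of "item_reward m"]
      unfolding ip_feasible_def mem_Collect_eq *[of "\<lambda>\<xi> x. item_consumption m \<xi> x k" for k]
      by (elim conjE, intro conjI)
  qed
  have inv: "?P (inv \<sigma>) (?P \<sigma> x) = x"
    if "\<sigma> permutes {..<s}" "x \<in> extensional {..<s}" for \<sigma> and x :: "nat \<Rightarrow> 'z"
    using that(2) in_s[OF permutes_inv[OF that(1)]] permutes_inverses[OF that(1)]
    by (auto simp: fun_eq_iff extensional_def)
  have opt: "?P \<sigma> x \<in> ip_optimal m d s \<beta> (?P \<sigma> I)"
    if \<sigma>: "\<sigma> permutes {..<s}" and x: "x \<in> ip_optimal m d s \<beta> I" and I: "I \<in> extensional {..<s}"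
    for \<sigma> I and x :: "nat \<Rightarrow> decision"
  proof -
    have x': "x \<in> ip_feasible m d s \<beta> I"
      and x'': "\<forall>y \<in> {..<s} \<rightarrow>\<^sub>E Delta m. y \<in> ip_feasible m d s \<beta> I \<longrightarrow>
        (\<Sum>i<s. item_reward m (I i) (y i)) \<le> (\<Sum>i<s. item_reward m (I i) (x i))"
      using x unfolding ip_optimal_eq mem_Collect_eq by (rule conjunct1, rule conjunct2)
    have "(\<Sum>i<s. item_reward m (?P \<sigma> I i) (y i)) \<le> (\<Sum>i<s. item_reward m (?P \<sigma> I i) (?P \<sigma> x i))"
      if y: "y \<in> ip_feasible m d s \<beta> (?P \<sigma> I)" for y
    proof -
      note f = feas[OF permutes_inv[OF \<sigma>] y, unfolded inv[OF \<sigma> I]]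
      have y': "?P (inv \<sigma>) y \<in> ip_feasible m d s \<beta> I"
        "(\<Sum>i<s. item_reward m (?P \<sigma> I i) (y i)) = (\<Sum>i<s. item_reward m (I i) (?P (inv \<sigma>) y i))"
        by (rule f[THEN conjunct1], rule f[THEN conjunct2, symmetric])
      have "?P (inv \<sigma>) y \<in> {..<s} \<rightarrow>\<^sub>E Delta m"
        by (rule subsetD[OF ip_feasible_subset y'(1)])
      then have "(\<Sum>i<s. item_reward m (I i) (?P (inv \<sigma>) y i)) \<le> (\<Sum>i<s. item_reward m (I i) (x i))"
        by (rule mp[OF bspec[OF x''] y'(1)])
      then show ?thesis unfolding y'(2) feas[OF \<sigma> x', THEN conjunct2] .
    qed
    then show ?thesis
      using feas[OF \<sigma> x', THEN conjunct1] unfolding ip_optimal_eq mem_Collect_eq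
      by (intro conjI ballI impI)
  qed
  have ext: "x \<in> extensional {..<s}" if "x \<in> ip_optimal m d s \<beta> I" for x I
    using that by (auto simp: ip_optimal_eq ip_feasible_def PiE_def)
  have Iext: "I \<in> extensional {..<s}" using I by (auto simp: PiE_def)
  have PI: "?P \<pi> I \<in> extensional {..<s}" by simp
  have inv2: "?P \<pi> (?P (inv \<pi>) x) = x" if "x \<in> extensional {..<s}" for x :: "nat \<Rightarrow> decision"
    using inv[OF permutes_inv[OF \<pi>] that] permutes_inv_inv[OF \<pi>] by simp
  have img: "ip_optimal m d s \<beta> (?P \<pi> I) = ?P \<pi> ` ip_optimal m d s \<beta> I"
  proof (intro equalityI subsetI)
    fix x assume x: "x \<in> ip_optimal m d s \<beta> (?P \<pi> I)"
    have "?P (inv \<pi>) x \<in> ip_optimal m d s \<beta> I"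
      using opt[OF permutes_inv[OF \<pi>] x PI] unfolding inv[OF \<pi> Iext] .
    then show "x \<in> ?P \<pi> ` ip_optimal m d s \<beta> I"
      by (rule image_eqI[where f = "?P \<pi>", OF inv2[OF ext[OF x], symmetric]])
  next
    fix x assume "x \<in> ?P \<pi> ` ip_optimal m d s \<beta> I"
    then obtain y where "x = ?P \<pi> y" "y \<in> ip_optimal m d s \<beta> I" by (elim imageE)
    then show "x \<in> ip_optimal m d s \<beta> (?P \<pi> I)" by (simp only: opt[OF \<pi> _ Iext])
  qed
  have "inj_on (?P \<pi>) (ip_optimal m d s \<beta> I)"
    by (rule inj_on_inverseI[where g = "?P (inv \<pi>)"]) (rule inv[OF \<pi> ext])
  moreover have "finite (ip_optimal m d s \<beta> I)"
    by (rule finite_subset[OF _ finite_ip_solutions[of s m]]) (auto simp: ip_optimal_eq ip_feasible_def)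
  ultimately show "uniform_solver m d s \<beta> (?P \<pi> I) = map_pmf (?P \<pi>) (uniform_solver m d s \<beta> I)"
    using ip_optimal_nonempty[OF \<beta>] by (simp add: uniform_solver_def img map_pmf_of_set_inj)
qed

corollary exact_equivariant_solver_exists:
  "\<exists>sol. exact_solver m d sol \<and> equivariant_solver m d sol"
  using uniform_solver_exact uniform_solver_equivariant by blast


section \<open>The random runs are well defined\<close>

text \<open>
  The monadic bind of the Giry monad is meaningful only for measurable kernels; all those
  occurring in the runs of the two policies are.
\<close>

lemma item_reward_measurable [measurable (raw)]:
  assumes "f \<in> N \<rightarrow>\<^sub>M item_space m d" "g \<in> N \<rightarrow>\<^sub>M count_space UNIV"
  shows "(\<lambda>w. item_reward m (f w) (g w)) \<in> borel_measurable N"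
proof -
  have [measurable]: "(\<lambda>w. g w j) \<in> borel_measurable N" for j
    using measurable_compose[OF assms(2), of "\<lambda>x. x j" borel] by simp
  have [measurable]: "(\<lambda>w. fst (f w) j) \<in> borel_measurable N" if "j < m" for j
    using that assms(1) unfolding item_space_def by (measurable, auto)
  show ?thesis unfolding item_reward_def by measurable
qed

lemma item_consumption_measurable [measurable (raw)]:
  assumes "f \<in> N \<rightarrow>\<^sub>M item_space m d" "g \<in> N \<rightarrow>\<^sub>M count_space UNIV" "k < d"
  shows "(\<lambda>w. item_consumption m (f w) (g w) k) \<in> borel_measurable N"
proof -
  have [measurable]: "(\<lambda>w. g w j) \<in> borel_measurable N" for j
    using measurable_compose[OF assms(2), of "\<lambda>x. x j" borel] by simp
  have [measurable]: "(\<lambda>w. snd (f w) j k) \<in> borel_measurable N" if "j < m" for j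
    using measurable_compose[OF assms(1) snd_component_measurable[OF that assms(3)]] .
  show ?thesis unfolding item_consumption_def by measurable
qed

definition measurable_policy :: "nat \<Rightarrow> nat \<Rightarrow> policy \<Rightarrow> bool" where
  "measurable_policy m d p \<longleftrightarrow>
     (\<forall>n. (\<lambda>(\<beta>, \<xi>). p n \<beta> \<xi>)
            \<in> capacity_space d \<Otimes>\<^sub>M item_space m d \<rightarrow>\<^sub>M prob_algebra (count_space UNIV))"

lemma run_measurable:
  assumes D: "D \<in> space (prob_algebra (item_space m d))" and p: "measurable_policy m d p"
  shows "(\<lambda>(\<beta>, v). run m d D p n \<beta> v) \<in> capacity_space d \<Otimes>\<^sub>M borel \<rightarrow>\<^sub>M prob_algebra borel"
proof (induction n)
  case (Suc n)
  let ?K = "(capacity_space d \<Otimes>\<^sub>M borel) \<Otimes>\<^sub>M item_space m d"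
  have "(\<lambda>w. (fst (fst w), snd w)) \<in> ?K \<rightarrow>\<^sub>M capacity_space d \<Otimes>\<^sub>M item_space m d"
    by measurable
  then have pm: "(\<lambda>w. p n (fst (fst w)) (snd w)) \<in> ?K \<rightarrow>\<^sub>M prob_algebra (count_space UNIV)"
    using measurable_compose p[unfolded measurable_policy_def, rule_format, of n] by fastforce
  let ?N = "((capacity_space d \<Otimes>\<^sub>M borel) \<Otimes>\<^sub>M item_space m d) \<Otimes>\<^sub>M count_space UNIV"
  have cap: "(\<lambda>w. \<lambda>k\<in>{..<d}. fst (fst (fst w)) k - item_consumption m (snd (fst w)) (snd w) k)
     \<in> ?N \<rightarrow>\<^sub>M capacity_space d"
    unfolding capacity_space_def
    by (rule measurable_restrict) (unfold capacity_space_def[symmetric], measurable)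
  have "(\<lambda>w. (\<lambda>k\<in>{..<d}. fst (fst (fst w)) k - item_consumption m (snd (fst w)) (snd w) k,
      snd (fst (fst w)) + item_reward m (snd (fst w)) (snd w))) \<in> ?N \<rightarrow>\<^sub>M capacity_space d \<Otimes>\<^sub>M borel"
    by (intro measurable_Pair cap) measurable
  note next_run = measurable_compose[OF this Suc.IH]
  have inner: "(\<lambda>w. p n (fst (fst w)) (snd w) \<bind> (\<lambda>x. run m d D p n
       (\<lambda>k\<in>{..<d}. fst (fst w) k - item_consumption m (snd w) x k)
      (snd (fst w) + item_reward m (snd w) x))) \<in> (capacity_space d \<Otimes>\<^sub>M borel) \<Otimes>\<^sub>M item_space m d \<rightarrow>\<^sub>M prob_algebra borel"
    by (rule measurable_bind_prob_space2[OF pm]) (use next_run in \<open>simp add: split_beta'\<close>)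
  show ?case
    unfolding run.simps split_beta'
    by (rule measurable_bind_prob_space2[OF measurable_const[OF D]]) (use inner in \<open>simp add: split_beta'\<close>)
qed (simp add: measurable_return_prob_space split_beta' )

lemma solver_prob:
  assumes "exact_solver m d sol"
  shows "(\<lambda>(\<beta>, I). measure_pmf (map_pmf (\<lambda>x. x 0) (sol s \<beta> I)))
            \<in> capacity_space d \<Otimes>\<^sub>M (\<Pi>\<^sub>M i\<in>{..<s}. item_space m d) \<rightarrow>\<^sub>M prob_algebra (count_space UNIV)"
proof (rule measurable_prob_algebraI)
  note K = assms[unfolded exact_solver_def, THEN conjunct1, rule_format, of s]
  show "(\<lambda>(\<beta>, I). measure_pmf (map_pmf (\<lambda>x. x 0) (sol s \<beta> I)))
            \<in> capacity_space d \<Otimes>\<^sub>M (\<Pi>\<^sub>M i\<in>{..<s}. item_space m d) \<rightarrow>\<^sub>M subprob_algebra (count_space UNIV)"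
    using measurable_compose[OF K measurable_distr[of "\<lambda>x. x 0" "count_space UNIV" "count_space UNIV"]]
    by (simp add: map_pmf_rep_eq split_beta')
qed (auto simp: measure_pmf.prob_space_axioms)

lemma measurable_policy_oso:
  assumes "prob_space D" "sets D = sets (item_space m d)" "exact_solver m d sol"
  shows "measurable_policy m d (single_sample_oso D sol)"
  unfolding measurable_policy_def
proof
  fix n :: nat
  interpret prob_space D by fact
  interpret product_prob_space "\<lambda>_. D" "{1..n}" by unfold_locales
  have "prob_space (\<Pi>\<^sub>M i\<in>{1..n}. D)" by unfold_locales
  then have P: "(\<Pi>\<^sub>M i\<in>{1..n}. D) \<in> space (prob_algebra (\<Pi>\<^sub>M i\<in>{1..n}. item_space m d))"
    using assms(2) by (auto simp: space_prob_algebra intro!: sets_PiM_cong)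
  have eq: "insert (0::nat) {1..n} = {..<Suc n}" by auto
  have upd: "(\<lambda>w. fun_upd (snd w) 0 (snd (fst w))) \<in>
     (capacity_space d \<Otimes>\<^sub>M item_space m d) \<Otimes>\<^sub>M (\<Pi>\<^sub>M i\<in>{1..n}. item_space m d) \<rightarrow>\<^sub>M (\<Pi>\<^sub>M i\<in>{..<Suc n}. item_space m d)"
    by (rule measurable_fun_upd[where J = "{1..n}"]) (use eq in auto)
  show "(\<lambda>(\<beta>, \<xi>). single_sample_oso D sol n \<beta> \<xi>) \<in>
   capacity_space d \<Otimes>\<^sub>M item_space m d \<rightarrow>\<^sub>M prob_algebra (count_space UNIV)"
    unfolding single_sample_oso_def split_beta'
    apply (rule measurable_bind_prob_space2[OF measurable_const[OF P]])
    using measurable_compose[OF measurable_Pair[OF _ upd] solver_prob[OF assms(3), of "Suc n"], of "\<lambda>w. fst (fst w)"]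
    by (simp add: split_beta')
qed

lemma measurable_policy_myopic:
  assumes "exact_solver m d sol"
  shows "measurable_policy m d (myopic sol)"
  unfolding measurable_policy_def
proof
  fix n :: nat
  have "(\<lambda>w. \<lambda>i\<in>{..<1::nat}. snd w) \<in>
     capacity_space d \<Otimes>\<^sub>M item_space m d \<rightarrow>\<^sub>M (\<Pi>\<^sub>M i\<in>{..<1}. item_space m d)"
    by (rule measurable_restrict) simp
  from measurable_compose[OF measurable_Pair[OF measurable_fst this] solver_prob[OF assms, of 1]]
  show "(\<lambda>(\<beta>, \<xi>). myopic sol n \<beta> \<xi>)
      \<in> capacity_space d \<Otimes>\<^sub>M item_space m d \<rightarrow>\<^sub>M prob_algebra (count_space UNIV)"
    by (simp add: myopic_def split_beta')
qed

corollary run_prob_algebra: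
  assumes "allocation_instance T m d b D" "measurable_policy m d p"
  shows "run m d D p T b 0 \<in> space (prob_algebra borel)"
proof -
  have "D \<in> space (prob_algebra (item_space m d))"
    using assms(1) by (simp add: allocation_instance_def space_prob_algebra)
  moreover have "b \<in> space (capacity_space d)"
    using assms(1) by (auto simp: allocation_instance_def capacity_space_def space_PiM PiE_iff)
  ultimately show ?thesis
    using measurable_space[OF run_measurable[OF _ assms(2), of D T], of "(b, 0)"]
    by (simp add: space_pair_measure)
qed

end

theory Submission
  imports Defs
begin

text \<open>
  One resource with capacity \<open>T\<close> and one supply node suffice. An item is a \<^emph>\<open>filler\<close> with
  probability \<open>p\<close> (reward \<open>1\<close>, consumption \<open>1\<close>) and otherwise a \<^emph>\<open>blocker\<close> (reward
  \<open>eps\<close> with \<open>0 < eps < 1\<close>, consumption \<open>T\<close>). A blocker fits only while nothing has been accepted, and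
  once accepted it exhausts the resource; on the other hand all \<open>T\<close> items could be fillers
  without ever exceeding the capacity.

  The myopic policy accepts the first item, whatever it is. With probability \<open>1 - p\<close> this is a
  blocker, and the total reward is \<open>eps\<close>; otherwise at most \<open>p (T - 1)\<close> is added in expectation
  to the reward of the first filler. Hence its expected reward is at most
  \<open>p (1 + p T) + (1 - p) eps\<close> (lemma \<open>myopic_reward_le\<close>), and for fixed \<open>p\<close> its growth in
  \<open>T\<close> has slope \<open>p\<^sup>2\<close>.

  For single-sample OSO, the key is the shape of the optimal solutions (lemma
  \<open>ip_optimal_with_filler\<close>): as soon as the current item or one of the sampled items is a filler,
  and there is room for all of them, every optimal solution takes exactly the fillers, because a
  blocker is worth less than a single filler. So, until it accepts a blocker, OSO takes every
  filler, and it takes a blocker with \<open>n\<close> items to come only if all \<open>n\<close> samples are blockers,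
  which has probability \<open>(1 - p)^n\<close> (lemma \<open>prob_oso_rejects_blocker\<close>). Even weighted with the
  \<open>n\<close> items at stake, these probabilities are summable, so the mistakes cost only a constant
  independent of \<open>T\<close>: the expected reward is at least \<open>p T - 1 / p\<close> (lemma
  \<open>oso_reward_ge\<close>), which grows in \<open>T\<close> with slope \<open>p\<close>.

  The limit inferior of the ratio of the two rewards for \<open>T \<rightarrow> \<infinity>\<close> is therefore at least
  \<open>1 / p\<close>. The theorem follows by taking \<open>p = eps = 1 / K\<close> for a large natural number \<open>K\<close> and \<open>T\<close> quadratic in \<open>K\<close>.
\<close>

section \<open>The instance\<close>

(* The dimensions are the literal 1, which must not be rewritten to Suc 0. *)
declare One_nat_def [simp del]

lemma lessThan_one: "{..<1::nat} = {0}"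
  by auto

lemma item_reward_1: "item_reward 1 \<xi> x = fst \<xi> 0 * x 0"
  by (simp add: item_reward_def lessThan_one)

lemma item_consumption_1: "item_consumption 1 \<xi> x k = snd \<xi> 0 k * x 0"
  by (simp add: item_consumption_def lessThan_one)

lemma Delta_1_iff: "x \<in> Delta 1 \<longleftrightarrow> x \<in> {..<1} \<rightarrow>\<^sub>E {0, 1}"
  by (auto simp: Delta_def PiE_iff lessThan_one)

abbreviation cap :: "real \<Rightarrow> capacity" where
  "cap c \<equiv> (\<lambda>k\<in>{..<1::nat}. c)"

locale blocking_instance =
  fixes p eps :: real and T :: nat
  assumes p: "0 < p" "p < 1" and eps: "0 < eps" "eps < 1" and T: "1 \<le> T"
begin

text \<open>
  The type of an item is a truth value: \<open>True\<close> stands for fillers, \<open>False\<close> for blockers.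
\<close>

definition reward :: "bool \<Rightarrow> real" where
  "reward g = (if g then 1 else eps)"

definition weight :: "bool \<Rightarrow> real" where
  "weight g = (if g then 1 else real T)"

definition offer :: "bool \<Rightarrow> item" where
  "offer g = (\<lambda>j\<in>{..<1}. reward g, \<lambda>j\<in>{..<1}. \<lambda>k\<in>{..<1}. weight g)"

text \<open>
  Almost sure statements about sampled items compare only the entries that matter, so that
  their measurability reduces to that of the coordinates.
\<close>

definition looks_like :: "item \<Rightarrow> bool \<Rightarrow> bool" where
  "looks_like \<xi> g \<longleftrightarrow> fst \<xi> 0 = reward g \<and> snd \<xi> 0 0 = weight g"

definition D :: "item measure" where
  "D = distr (measure_pmf (bernoulli_pmf p)) (item_space 1 1) offer"

lemma reward_pos: "0 < reward g" and reward_le_1: "reward g \<le> 1"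
  using eps by (auto simp: reward_def)

lemma weight_ge_1: "1 \<le> weight g"
  using T by (auto simp: weight_def)

lemma looks_like_offer [simp]: "looks_like (offer g) h \<longleftrightarrow> g = h"
  using eps by (auto simp: looks_like_def offer_def reward_def)

lemma offer_in_space [simp]: "offer g \<in> space (item_space 1 1)"
  using T eps by (auto simp: offer_def item_space_def space_pair_measure space_PiM weight_def)

lemma offer_measurable [measurable]: "offer \<in> measure_pmf q \<rightarrow>\<^sub>M item_space 1 1"
  using offer_in_space by (auto simp: measurable_def)

lemma sets_D [measurable_cong]: "sets D = sets (item_space 1 1)"
  by (simp add: D_def)

lemma space_D: "space D = space (item_space 1 1)"
  by (simp add: D_def)

lemma prob_space_D: "prob_space D"
  unfolding D_def by (rule prob_space.prob_space_distr) (auto intro: measure_pmf.prob_space_axioms)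

lemma fst_measurable_0 [measurable]: "(\<lambda>\<xi>. fst \<xi> 0) \<in> borel_measurable (item_space 1 1)"
  unfolding item_space_def by measurable

lemma looks_like_measurable [measurable]: "Measurable.pred (item_space 1 1) (\<lambda>\<xi>. looks_like \<xi> g)"
proof -
  have [measurable]: "(\<lambda>\<xi>. snd \<xi> 0 0) \<in> borel_measurable (item_space 1 1)"
    by (rule snd_component_measurable) auto
  show ?thesis unfolding looks_like_def by measurable
qed

lemma AE_D_looks_like: "AE \<xi> in D. \<exists>g. looks_like \<xi> g"
  unfolding D_def by (subst AE_distr_iff) (auto intro!: AE_I2 exI simp del: not_ex)

lemma allocation_instance_D: "allocation_instance T 1 1 (cap (real T)) D"
proof -
  have "integrable D (\<lambda>\<xi>. fst \<xi> 0)"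
    unfolding D_def
    by (subst integrable_distr_eq) (auto simp: fst_measurable_0 intro!: integrable_measure_pmf_finite)
  then show ?thesis
    using T by (auto simp: allocation_instance_def prob_space_D sets_D)
qed

lemma nn_integral_D:
  assumes "f \<in> borel_measurable (item_space 1 1)"
  shows "(\<integral>\<^sup>+\<xi>. f \<xi> \<partial>D) = ennreal p * f (offer True) + ennreal (1 - p) * f (offer False)"
  using assms p unfolding D_def by (subst nn_integral_distr) (auto simp: mult.commute)

section \<open>Optimal solutions of the integer programs\<close>

lemma ip_feasible_total:
  assumes I: "\<forall>i<s. looks_like (I i) (g i)"
  shows "x \<in> ip_feasible 1 1 s (cap c) I \<longleftrightarrow>
    x \<in> {..<s} \<rightarrow>\<^sub>E Delta 1 \<and> (\<Sum>i<s. weight (g i) * x i 0) \<le> c"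
proof -
  have "(\<Sum>i<s. item_consumption 1 (I i) (x i) 0) = (\<Sum>i<s. weight (g i) * x i 0)"
    using I unfolding item_consumption_1 by (intro sum.cong) (auto simp: looks_like_def)
  then show ?thesis by (auto simp: ip_feasible_def)
qed

lemma ip_feasibleD:
  assumes I: "\<forall>i<s. looks_like (I i) (g i)"
    and x: "x \<in> ip_feasible 1 1 s (cap c) I" and i: "i < s"
  shows "x i 0 \<in> {0, 1}" "weight (g i) * x i 0 \<le> c"
proof -
  have xx: "x \<in> {..<s} \<rightarrow>\<^sub>E Delta 1" "(\<Sum>i<s. weight (g i) * x i 0) \<le> c"
    using ip_feasible_total[OF I] x by auto
  have x01: "x i 0 \<in> {0, 1}" if "i < s" for i
    using xx(1) that by (fastforce simp: Delta_1_iff PiE_iff)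
  then show "x i 0 \<in> {0, 1}" using i .
  have "weight (g i) * x i 0 \<le> (\<Sum>i<s. weight (g i) * x i 0)"
    using i
  proof (intro member_le_sum)
    fix j assume "j \<in> {..<s} - {i}"
    then have "x j 0 \<in> {0, 1}" using x01 by auto
    then show "0 \<le> weight (g j) * x j 0" using weight_ge_1[of "g j"] by auto
  qed auto
  then show "weight (g i) * x i 0 \<le> c" using xx(2) by linarith
qed

text \<open>
  Taking exactly the fillers is feasible, since there are at most \<open>s \<le> c\<close> of them. A solution
  that takes a blocker has no capacity left for anything else, so its reward \<open>eps\<close> is less
  than that of a single filler; a solution without blockers can match the reward of all fillers
  only by taking all of them.
\<close>

lemma ip_optimal_with_filler:
  assumes I: "\<forall>i<s. looks_like (I i) (g i)"
    and c: "real s \<le> c" "c \<le> real T" and ex: "k < s" "g k"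
    and x: "x \<in> ip_optimal 1 1 s (cap c) I" and i: "i < s"
  shows "x i 0 = (if g i then 1 else 0)"
proof -
  define y :: "nat \<Rightarrow> decision" where
    "y = (\<lambda>i\<in>{..<s}. \<lambda>j\<in>{..<1}. if g i then 1 else 0)"
  have xf: "x \<in> ip_feasible 1 1 s (cap c) I"
    using x by (simp add: ip_optimal_eq)
  note xD = ip_feasibleD[OF I xf]
  have total: "(\<Sum>i<s. weight (g i) * x i 0) \<le> c"
    using ip_feasible_total[OF I] xf by auto
  have yd: "y \<in> {..<s} \<rightarrow>\<^sub>E Delta 1"
    by (auto simp: y_def Delta_1_iff)
  have "(\<Sum>i<s. weight (g i) * y i 0) \<le> (\<Sum>i<s. 1)"
    by (intro sum_mono) (auto simp: y_def weight_def)
  then have "y \<in> ip_feasible 1 1 s (cap c) I"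
    using c(1) yd by (subst ip_feasible_total[OF I]) auto
  then have "(\<Sum>i<s. item_reward 1 (I i) (y i)) \<le> (\<Sum>i<s. item_reward 1 (I i) (x i))"
    using x yd unfolding ip_optimal_eq by blast
  moreover have "item_reward 1 (I i) (z i) = reward (g i) * z i 0" if "i < s" for i z
    using I that unfolding item_reward_1 by (simp add: looks_like_def)
  ultimately have le: "(\<Sum>i<s. reward (g i) * y i 0) \<le> (\<Sum>i<s. reward (g i) * x i 0)"
    by simp
  have y_val: "reward (g i) * y i 0 = (if g i then 1 else 0)" if "i < s" for i
    using that by (simp add: y_def reward_def)
  \<comment> \<open>As rewards are at most consumptions, the capacity that a blocker leaves also bounds the
    reward that can be collected besides it.\<close>
  have no_blocker: "x j 0 = 0" if j: "j < s" "\<not> g j" for j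
  proof (rule ccontr)
    assume "x j 0 \<noteq> 0"
    then have xj: "x j 0 = 1" using xD(1)[OF j(1)] by auto
    have "(\<Sum>i<s. reward (g i) * x i 0) = eps + (\<Sum>i\<in>{..<s} - {j}. reward (g i) * x i 0)"
      using j xj by (subst sum.remove[of _ j]) (auto simp: reward_def)
    also have "\<dots> \<le> eps + (\<Sum>i\<in>{..<s} - {j}. weight (g i) * x i 0)"
    proof (intro add_left_mono sum_mono mult_right_mono)
      fix i assume "i \<in> {..<s} - {j}"
      then show "reward (g i) \<le> weight (g i)" "0 \<le> x i 0"
        using reward_le_1[of "g i"] weight_ge_1[of "g i"] xD(1)[of i] by auto
    qed
    also have "\<dots> = eps + (\<Sum>i<s. weight (g i) * x i 0) - real T"
      using j xj by (subst (2) sum.remove[of _ j]) (auto simp: weight_def)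
    also have "\<dots> < 1" using total c(2) eps by linarith
    finally have "(\<Sum>i<s. reward (g i) * y i 0) < 1" using le by linarith
    moreover have "reward (g k) * y k 0 \<le> (\<Sum>i<s. reward (g i) * y i 0)"
      using ex by (intro member_le_sum) (auto simp: y_val)
    ultimately show False using y_val[OF ex(1)] ex(2) by simp
  qed
  \<comment> \<open>Hence \<open>x\<close> is dominated by \<open>y\<close> item by item, and equality of the totals forces equality
    for each item.\<close>
  have nonneg: "0 \<le> reward (g i) * y i 0 - reward (g i) * x i 0" if "i < s" for i
    using xD(1)[OF that] no_blocker[OF that] unfolding y_val[OF that] by (auto simp: reward_def)
  have "(\<Sum>i<s. reward (g i) * y i 0 - reward (g i) * x i 0) \<le> 0"
    using le by (simp add: sum_subtractf)
  then have "(\<Sum>i<s. reward (g i) * y i 0 - reward (g i) * x i 0) = 0"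
    using nonneg by (intro antisym sum_nonneg) auto
  then have "reward (g i) * y i 0 - reward (g i) * x i 0 = 0"
    using nonneg i by (subst (asm) sum_nonneg_eq_0_iff) auto
  then show ?thesis
    using no_blocker[OF i] unfolding y_val[OF i] by (auto simp: reward_def split: if_splits)
qed

lemma ip_optimal_single:
  assumes I: "looks_like (I 0) g" and c: "weight g \<le> c"
    and x: "x \<in> ip_optimal 1 1 1 (cap c) I"
  shows "x 0 0 = 1"
proof -
  have I': "\<forall>i<1. looks_like (I i) ((\<lambda>_. g) i)" using I by simp
  define y :: "nat \<Rightarrow> decision" where "y = (\<lambda>i\<in>{..<1}. \<lambda>j\<in>{..<1}. 1)"
  have yd: "y \<in> {..<1} \<rightarrow>\<^sub>E Delta 1"
    by (auto simp: y_def Delta_1_iff)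
  have "y \<in> ip_feasible 1 1 1 (cap c) I"
    using c yd by (subst ip_feasible_total[OF I']) (auto simp: y_def)
  then have "(\<Sum>i<1. item_reward 1 (I i) (y i)) \<le> (\<Sum>i<1. item_reward 1 (I i) (x i))"
    using x yd unfolding ip_optimal_eq by blast
  then have "reward g \<le> reward g * x 0 0"
    using I unfolding item_reward_1 by (simp add: looks_like_def y_def lessThan_one)
  moreover have "x 0 0 \<in> {0, 1}"
    using ip_feasibleD(1)[OF I', where x = x and c = c and i = 0] x by (simp add: ip_optimal_eq)
  ultimately show ?thesis using reward_pos[of g] by auto
qed

section \<open>Backward recursion for the total reward\<close>

text \<open>
  The recursion is stated for nonnegative integrals, where the bind of the Giry monad is a plain
  iterated integral. The test function \<open>f\<close> is the reward itself, or the indicator of the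
  negative numbers, which serves to show that the total reward is almost surely nonnegative.
\<close>

definition payoff :: "policy \<Rightarrow> (real \<Rightarrow> ennreal) \<Rightarrow> nat \<Rightarrow> real \<Rightarrow> real \<Rightarrow> ennreal" where
  "payoff pol f n c v = (\<integral>\<^sup>+w. f w \<partial>run 1 1 D pol n (cap c) v)"

definition choice_payoff ::
    "policy \<Rightarrow> (real \<Rightarrow> ennreal) \<Rightarrow> nat \<Rightarrow> real \<Rightarrow> real \<Rightarrow> bool \<Rightarrow> ennreal" where
  "choice_payoff pol f n c v g =
     (\<integral>\<^sup>+x. payoff pol f n (c - weight g * x 0) (v + reward g * x 0) \<partial>pol n (cap c) (offer g))"

lemma D_in_prob_algebra: "D \<in> space (prob_algebra (item_space 1 1))"
  by (simp add: space_prob_algebra prob_space_D sets_D)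

lemma cap_in_space: "cap c \<in> space (capacity_space 1)"
  by (simp add: capacity_space_def space_PiM)

lemma policy_in_prob_algebra:
  assumes "measurable_policy 1 1 pol"
  shows "pol n (cap c) (offer g) \<in> space (prob_algebra (count_space UNIV))"
  using measurable_space[OF assms[unfolded measurable_policy_def, rule_format, of n], of "(cap c, offer g)"]
  by (simp add: space_pair_measure cap_in_space offer_in_space)

lemma payoff_0: "f \<in> borel_measurable borel \<Longrightarrow> payoff pol f 0 c v = f v"
  by (simp add: payoff_def nn_integral_return)

lemma payoff_Suc:
  assumes pol: "measurable_policy 1 1 pol" and f: "f \<in> borel_measurable borel"
  shows "payoff pol f (Suc n) c v =
    ennreal p * choice_payoff pol f n c v True + ennreal (1 - p) * choice_payoff pol f n c v False"
proof -
  let ?next = "\<lambda>\<xi> x. run 1 1 D pol n (\<lambda>k\<in>{..<1}. cap c k - item_consumption 1 \<xi> x k)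
     (v + item_reward 1 \<xi> x)"
  let ?N = "item_space 1 1 \<Otimes>\<^sub>M count_space (UNIV :: decision set)"
  have cap_meas: "(\<lambda>w. \<lambda>k\<in>{..<1}. cap c k - item_consumption 1 (fst w) (snd w) k) \<in> ?N \<rightarrow>\<^sub>M capacity_space 1"
    unfolding capacity_space_def by (rule measurable_restrict) measurable
  have "(\<lambda>w. (\<lambda>k\<in>{..<1}. cap c k - item_consumption 1 (fst w) (snd w) k,
      v + item_reward 1 (fst w) (snd w))) \<in> ?N \<rightarrow>\<^sub>M capacity_space 1 \<Otimes>\<^sub>M borel"
    by (intro measurable_Pair cap_meas) measurable
  from measurable_compose[OF this run_measurable[OF D_in_prob_algebra pol, of n]]
  have next_meas: "(\<lambda>(\<xi>, x). ?next \<xi> x) \<in> ?N \<rightarrow>\<^sub>M prob_algebra borel"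
    by (simp add: split_beta')
  have pol_meas: "pol n (cap c) \<in> item_space 1 1 \<rightarrow>\<^sub>M prob_algebra (count_space UNIV)"
    using measurable_compose[OF measurable_Pair1'[OF cap_in_space] pol[unfolded measurable_policy_def, rule_format, of n]]
    by simp
  let ?step = "\<lambda>\<xi>. pol n (cap c) \<xi> \<bind> ?next \<xi>"
  have step_meas: "?step \<in> D \<rightarrow>\<^sub>M subprob_algebra borel"
    using measurable_prob_algebraD[OF measurable_bind_prob_space2[OF pol_meas next_meas]]
    by (simp cong: measurable_cong_sets add: sets_D)
  have step_offer: "(\<integral>\<^sup>+w. f w \<partial>?step (offer g)) = choice_payoff pol f n c v g" for g
  proof -
    have "?next (offer g) \<in> count_space UNIV \<rightarrow>\<^sub>M subprob_algebra borel"
      using measurable_prob_algebraD[OF measurable_compose[OF measurable_Pair1'[OF offer_in_space[of g]] next_meas]]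
      by simp
    moreover have "sets (pol n (cap c) (offer g)) = sets (count_space UNIV)"
      using policy_in_prob_algebra[OF pol, of n c g] by (simp add: space_prob_algebra)
    ultimately have "?next (offer g) \<in> pol n (cap c) (offer g) \<rightarrow>\<^sub>M subprob_algebra borel"
      by (metis (no_types, lifting) measurable_cong_sets)
    from nn_integral_bind[OF f this]
    have "(\<integral>\<^sup>+w. f w \<partial>?step (offer g)) =
       (\<integral>\<^sup>+x. \<integral>\<^sup>+w. f w \<partial>?next (offer g) x \<partial>pol n (cap c) (offer g))" .
    moreover have "(\<lambda>k\<in>{..<1}. cap c k - item_consumption 1 (offer g) x k) = cap (c - weight g * x 0)" for x
      by (auto simp: item_consumption_1 fun_eq_iff offer_def)
    moreover have "item_reward 1 (offer g) x = reward g * x 0" for x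
      unfolding item_reward_1 by (simp add: offer_def)
    ultimately show ?thesis by (simp add: choice_payoff_def payoff_def)
  qed
  have "payoff pol f (Suc n) c v = (\<integral>\<^sup>+\<xi>. \<integral>\<^sup>+w. f w \<partial>?step \<xi> \<partial>D)"
    unfolding payoff_def run.simps by (rule nn_integral_bind[OF f step_meas])
  also have "\<dots> = ennreal p * (\<integral>\<^sup>+w. f w \<partial>?step (offer True)) + ennreal (1 - p) * (\<integral>\<^sup>+w. f w \<partial>?step (offer False))"
  proof (rule nn_integral_D)
    have "(\<lambda>\<xi>. \<integral>\<^sup>+w. f w \<partial>?step \<xi>) \<in> borel_measurable D"
      by (rule measurable_compose[OF step_meas nn_integral_measurable_subprob_algebra[OF f]])
    then show "(\<lambda>\<xi>. \<integral>\<^sup>+w. f w \<partial>?step \<xi>) \<in> borel_measurable (item_space 1 1)"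
      by (simp cong: measurable_cong_sets add: sets_D)
  qed
  finally show ?thesis by (simp only: step_offer)
qed

lemma prob_space_policy:
  "measurable_policy 1 1 pol \<Longrightarrow> prob_space (pol n (cap c) (offer g))"
  using policy_in_prob_algebra by (simp add: space_prob_algebra)

lemma sets_policy:
  "measurable_policy 1 1 pol \<Longrightarrow> sets (pol n (cap c) (offer g)) = UNIV"
  using policy_in_prob_algebra by (simp add: space_prob_algebra)

lemma choice_payoff_ge:
  assumes "measurable_policy 1 1 pol"
    and "AE x in pol n (cap c) (offer g).
      a \<le> payoff pol f n (c - weight g * x 0) (v + reward g * x 0)"
  shows "a \<le> choice_payoff pol f n c v g"
proof -
  interpret prob_space "pol n (cap c) (offer g)" by (rule prob_space_policy[OF assms(1)])
  have "(\<integral>\<^sup>+x. a \<partial>pol n (cap c) (offer g)) \<le> choice_payoff pol f n c v g"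
    unfolding choice_payoff_def by (rule nn_integral_mono_AE[OF assms(2)])
  then show ?thesis by (simp add: emeasure_space_1)
qed

lemma choice_payoff_le:
  assumes "measurable_policy 1 1 pol"
    and "AE x in pol n (cap c) (offer g).
      payoff pol f n (c - weight g * x 0) (v + reward g * x 0) \<le> a"
  shows "choice_payoff pol f n c v g \<le> a"
proof -
  interpret prob_space "pol n (cap c) (offer g)" by (rule prob_space_policy[OF assms(1)])
  have "choice_payoff pol f n c v g \<le> (\<integral>\<^sup>+x. a \<partial>pol n (cap c) (offer g))"
    unfolding choice_payoff_def by (rule nn_integral_mono_AE[OF assms(2)])
  then show ?thesis by (simp add: emeasure_space_1)
qed

lemma mixture_ennreal:
  "0 \<le> a \<Longrightarrow> 0 \<le> b \<Longrightarrow>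
    ennreal p * ennreal a + ennreal (1 - p) * ennreal b = ennreal (p * a + (1 - p) * b)"
  using p by (simp add: ennreal_mult ennreal_plus)

lemma payoff_Suc_ge:
  assumes "measurable_policy 1 1 pol"
    and "ennreal a \<le> choice_payoff pol ennreal n c v True" "0 \<le> a"
    and "ennreal b \<le> choice_payoff pol ennreal n c v False" "0 \<le> b"
    and "u \<le> p * a + (1 - p) * b"
  shows "ennreal u \<le> payoff pol ennreal (Suc n) c v"
proof -
  have "ennreal u \<le> ennreal (p * a + (1 - p) * b)"
    using assms(6) by (rule ennreal_leI)
  also have "\<dots> \<le> payoff pol ennreal (Suc n) c v"
    using assms(2,4) unfolding payoff_Suc[OF assms(1) measurable_ennreal]
      mixture_ennreal[OF assms(3,5), symmetric]
    by (intro add_mono mult_left_mono) auto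
  finally show ?thesis .
qed

lemma payoff_Suc_le:
  assumes "measurable_policy 1 1 pol"
    and "choice_payoff pol ennreal n c v True \<le> ennreal a" "0 \<le> a"
    and "choice_payoff pol ennreal n c v False \<le> ennreal b" "0 \<le> b"
    and "p * a + (1 - p) * b \<le> u"
  shows "payoff pol ennreal (Suc n) c v \<le> ennreal u"
proof -
  have "payoff pol ennreal (Suc n) c v \<le> ennreal (p * a + (1 - p) * b)"
    using assms(2,4) unfolding payoff_Suc[OF assms(1) measurable_ennreal]
      mixture_ennreal[OF assms(3,5), symmetric]
    by (intro add_mono mult_left_mono) auto
  also have "\<dots> \<le> ennreal u"
    using assms(6) by (rule ennreal_leI)
  finally show ?thesis .
qed

definition admissible :: "policy \<Rightarrow> bool" where
  "admissible pol \<longleftrightarrow> measurable_policy 1 1 pol \<and>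
     (\<forall>n c g. 0 \<le> c \<longrightarrow> (AE x in pol n (cap c) (offer g). x 0 \<in> {0, 1} \<and> weight g * x 0 \<le> c))"

lemma admissibleD:
  assumes "admissible pol"
  shows "measurable_policy 1 1 pol"
    and "0 \<le> c \<Longrightarrow> AE x in pol n (cap c) (offer g). x 0 \<in> {0, 1} \<and> weight g * x 0 \<le> c"
  using assms by (auto simp: admissible_def)

text \<open>
  Rewards are nonnegative, so mass on negative totals can only come from a negative initial value.
\<close>

lemma payoff_negative:
  assumes "admissible pol" "0 \<le> c" "0 \<le> v"
  shows "payoff pol (indicator {..<0}) n c v = 0"
  using assms(2,3)
proof (induction n arbitrary: c v)
  case (Suc n)
  have "choice_payoff pol (indicator {..<0}) n c v g \<le> 0" for g
  proof (rule choice_payoff_le[OF admissibleD(1)[OF assms(1)]])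
    show "AE x in pol n (cap c) (offer g).
        payoff pol (indicator {..<0}) n (c - weight g * x 0) (v + reward g * x 0) \<le> 0"
      using admissibleD(2)[OF assms(1) Suc.prems(1), where n = n and g = g]
    proof eventually_elim
      case (elim x)
      then show ?case
        using Suc.prems reward_pos[of g] by (subst Suc.IH) auto
    qed
  qed
  then show ?case
    by (simp add: payoff_Suc[OF admissibleD(1)[OF assms(1)]])
qed (simp add: payoff_0)

lemma payoff_ge_current:
  assumes "admissible pol" "0 \<le> c" "0 \<le> v"
  shows "ennreal v \<le> payoff pol ennreal n c v"
  using assms(2,3)
proof (induction n arbitrary: c v)
  case (Suc n)
  have "ennreal v \<le> choice_payoff pol ennreal n c v g" for g
  proof (rule choice_payoff_ge[OF admissibleD(1)[OF assms(1)]])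
    show "AE x in pol n (cap c) (offer g).
        ennreal v \<le> payoff pol ennreal n (c - weight g * x 0) (v + reward g * x 0)"
      using admissibleD(2)[OF assms(1) Suc.prems(1), where n = n and g = g]
    proof eventually_elim
      case (elim x)
      have "0 \<le> reward g * x 0" using elim reward_pos[of g] by auto
      then have "ennreal v \<le> ennreal (v + reward g * x 0)" by (intro ennreal_leI) simp
      also have "\<dots> \<le> payoff pol ennreal n (c - weight g * x 0) (v + reward g * x 0)"
        using elim Suc.prems \<open>0 \<le> reward g * x 0\<close> by (intro Suc.IH) auto
      finally show ?case .
    qed
  qed
  from payoff_Suc_ge[OF admissibleD(1)[OF assms(1)] this _ this] show ?case
    using Suc.prems p by (simp add: algebra_simps)
qed (simp add: payoff_0)

lemma payoff_le_length:
  assumes "admissible pol" "0 \<le> c" "0 \<le> v"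
  shows "payoff pol ennreal n c v \<le> ennreal (v + real n)"
  using assms(2,3)
proof (induction n arbitrary: c v)
  case (Suc n)
  have "choice_payoff pol ennreal n c v g \<le> ennreal (v + real (Suc n))" for g
  proof (rule choice_payoff_le[OF admissibleD(1)[OF assms(1)]])
    show "AE x in pol n (cap c) (offer g).
        payoff pol ennreal n (c - weight g * x 0) (v + reward g * x 0) \<le> ennreal (v + real (Suc n))"
      using admissibleD(2)[OF assms(1) Suc.prems(1), where n = n and g = g]
    proof eventually_elim
      case (elim x)
      have r: "0 \<le> reward g * x 0" "reward g * x 0 \<le> 1"
        using elim reward_pos[of g] reward_le_1[of g] by auto
      have "payoff pol ennreal n (c - weight g * x 0) (v + reward g * x 0) \<le> ennreal (v + reward g * x 0 + real n)"
        using elim Suc.prems r by (intro Suc.IH) auto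
      also have "\<dots> \<le> ennreal (v + real (Suc n))"
        using r by (intro ennreal_leI) simp
      finally show ?case .
    qed
  qed
  note le = this
  show ?case
    by (rule payoff_Suc_le[OF admissibleD(1)[OF assms(1)] le _ le])
       (use Suc.prems p in \<open>auto simp: algebra_simps\<close>)
qed (simp add: payoff_0)

text \<open>
  The total reward lies almost surely in \<open>{0..}\<close>, and its mean is at most \<open>T\<close>; so the Bochner
  integral and the nonnegative integral agree, and bounds on \<open>payoff\<close> carry over.
\<close>

lemma expected_total_reward_eq:
  assumes "admissible pol"
  shows "ennreal (expected_total_reward T 1 1 (cap (real T)) D pol) = payoff pol ennreal T (real T) 0"
    and "0 \<le> expected_total_reward T 1 1 (cap (real T)) D pol"
proof -
  let ?R = "run 1 1 D pol T (cap (real T)) 0"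
  have sets_R [measurable_cong]: "sets ?R = sets borel"
    using run_prob_algebra[OF allocation_instance_D admissibleD(1)[OF assms]]
    by (simp add: space_prob_algebra)
  have "emeasure ?R {..<0} = (\<integral>\<^sup>+w. indicator {..<0} w \<partial>?R)"
    by (subst nn_integral_indicator) (auto simp: sets_R)
  also have "\<dots> = 0"
    using payoff_negative[OF assms, of "real T" 0 T] by (simp add: payoff_def)
  finally have "AE w in ?R. w \<notin> {..<0}"
    by (intro AE_not_in) (auto simp: null_sets_def sets_R)
  then have nonneg: "AE w in ?R. 0 \<le> w"
    by eventually_elim auto
  have "(\<lambda>w. w) \<in> borel_measurable ?R" by (rule measurable_ident_sets[OF sets_R])
  from integral_eq_nn_integral[OF this nonneg]
  have "expected_total_reward T 1 1 (cap (real T)) D pol = enn2real (payoff pol ennreal T (real T) 0)"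
    unfolding expected_total_reward_def payoff_def .
  moreover have "payoff pol ennreal T (real T) 0 < top"
    using payoff_le_length[OF assms, of "real T" 0 T] by (rule le_less_trans) auto
  ultimately show "ennreal (expected_total_reward T 1 1 (cap (real T)) D pol) = payoff pol ennreal T (real T) 0"
    and "0 \<le> expected_total_reward T 1 1 (cap (real T)) D pol"
    by simp_all
qed

text \<open>
  Every item consumes at least one unit, so nothing fits any more.
\<close>

lemma payoff_exhausted:
  assumes "admissible pol" "0 \<le> v"
  shows "payoff pol ennreal n 0 v \<le> ennreal v"
proof (induction n)
  case (Suc n)
  have "choice_payoff pol ennreal n 0 v g \<le> ennreal v" for g
  proof (rule choice_payoff_le[OF admissibleD(1)[OF assms(1)]])
    show "AE x in pol n (cap 0) (offer g).
        payoff pol ennreal n (0 - weight g * x 0) (v + reward g * x 0) \<le> ennreal v"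
      using admissibleD(2)[OF assms(1) order_refl, where n = n and g = g]
    proof eventually_elim
      case (elim x)
      then have "x 0 = 0" using weight_ge_1[of g] by auto
      then show ?case using Suc by simp
    qed
  qed
  from payoff_Suc_le[OF admissibleD(1)[OF assms(1)] this _ this] show ?case
    using assms p by (simp add: algebra_simps)
qed (simp add: payoff_0)

text \<open>
  Below capacity \<open>T\<close> no blocker fits, and each later item contributes at most the probability
  \<open>p\<close> of being a filler.
\<close>

lemma payoff_unblockable_le:
  assumes "admissible pol" "0 \<le> c" "c < real T" "0 \<le> v"
  shows "payoff pol ennreal n c v \<le> ennreal (v + p * real n)"
  using assms(2-4)
proof (induction n arbitrary: c v)
  case (Suc n)
  have "choice_payoff pol ennreal n c v g \<le> ennreal (v + (if g then 1 else 0) + p * real n)" for g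
  proof (rule choice_payoff_le[OF admissibleD(1)[OF assms(1)]])
    show "AE x in pol n (cap c) (offer g).
        payoff pol ennreal n (c - weight g * x 0) (v + reward g * x 0)
          \<le> ennreal (v + (if g then 1 else 0) + p * real n)"
      using admissibleD(2)[OF assms(1) Suc.prems(1), where n = n and g = g]
    proof eventually_elim
      case (elim x)
      have r: "0 \<le> reward g * x 0" "reward g * x 0 \<le> (if g then 1 else 0)" "0 \<le> weight g * x 0"
        using elim eps Suc.prems by (auto simp: reward_def weight_def)
      have "payoff pol ennreal n (c - weight g * x 0) (v + reward g * x 0) \<le> ennreal (v + reward g * x 0 + p * real n)"
        using elim Suc.prems r by (intro Suc.IH) auto
      also have "\<dots> \<le> ennreal (v + (if g then 1 else 0) + p * real n)"
        using r by (intro ennreal_leI) simp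
      finally show ?case .
    qed
  qed
  note le = this
  show ?case
    by (rule payoff_Suc_le[OF admissibleD(1)[OF assms(1)] le[of True] _ le[of False]])
       (use Suc.prems p in \<open>auto simp: algebra_simps\<close>)
qed (simp add: payoff_0)

section \<open>The myopic policy\<close>

lemma solver_optimal:
  assumes "exact_solver 1 1 sol" "0 \<le> c" "I \<in> {..<s} \<rightarrow>\<^sub>E space (item_space 1 1)"
    and "x \<in> set_pmf (sol s (cap c) I)"
  shows "x \<in> ip_optimal 1 1 s (cap c) I"
proof -
  have "cap c \<in> {..<1} \<rightarrow>\<^sub>E {0..}" using assms(2) by auto
  then show ?thesis using assms unfolding exact_solver_def by blast
qed

lemma AE_myopic_optimal:
  assumes "exact_solver 1 1 sol" "0 \<le> c"
    and "\<And>x. x \<in> ip_optimal 1 1 1 (cap c) (\<lambda>i\<in>{..<1}. offer g) \<Longrightarrow> P (x 0)"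
  shows "AE x in myopic sol n (cap c) (offer g). P x"
proof -
  have "(\<lambda>i\<in>{..<1}. offer g) \<in> {..<1} \<rightarrow>\<^sub>E space (item_space 1 1)" by simp
  from solver_optimal[OF assms(1,2) this] assms(3) show ?thesis
    unfolding myopic_def by (auto simp: AE_measure_pmf_iff)
qed

lemma admissible_myopic:
  assumes "exact_solver 1 1 sol"
  shows "admissible (myopic sol)"
  unfolding admissible_def
proof (intro conjI allI impI)
  show "measurable_policy 1 1 (myopic sol)" by (rule measurable_policy_myopic[OF assms])
next
  fix n c g assume c: "0 \<le> (c::real)"
  have I: "\<forall>i<1. looks_like ((\<lambda>i\<in>{..<1}. offer g) i) ((\<lambda>_. g) i)" by simp
  show "AE x in myopic sol n (cap c) (offer g). x 0 \<in> {0, 1} \<and> weight g * x 0 \<le> c"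
  proof (rule AE_myopic_optimal[OF assms c])
    fix x assume "x \<in> ip_optimal 1 1 1 (cap c) (\<lambda>i\<in>{..<1}. offer g)"
    then have "x \<in> ip_feasible 1 1 1 (cap c) (\<lambda>i\<in>{..<1}. offer g)"
      by (simp only: ip_optimal_eq mem_Collect_eq)
    from ip_feasibleD[OF I this, of 0] show "x 0 0 \<in> {0, 1} \<and> weight g * x 0 0 \<le> c" by simp
  qed
qed

lemma myopic_accepts:
  assumes "exact_solver 1 1 sol" "weight g \<le> c"
  shows "AE x in myopic sol n (cap c) (offer g). x 0 = 1"
proof (rule AE_myopic_optimal[OF assms(1)])
  show "0 \<le> c" using assms(2) weight_ge_1[of g] by linarith
  show "x 0 0 = 1" if "x \<in> ip_optimal 1 1 1 (cap c) (\<lambda>i\<in>{..<1}. offer g)" for x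
    using ip_optimal_single[OF _ assms(2) that] by simp
qed

text \<open>
  The first item is accepted: a blocker leaves capacity \<open>0\<close>, a filler leaves \<open>T - 1\<close>.
\<close>

lemma myopic_reward_le:
  assumes "exact_solver 1 1 sol"
  shows "expected_total_reward T 1 1 (cap (real T)) D (myopic sol)
    \<le> p * (1 + p * real T) + (1 - p) * eps"
proof -
  let ?pol = "myopic sol"
  note adm = admissible_myopic[OF assms]
  obtain N where N: "Suc N = T" using T by (cases T) auto
  have wT: "weight g \<le> real T" for g using T by (simp add: weight_def)
  have "choice_payoff ?pol ennreal N (real T) 0 True \<le> ennreal (1 + p * real N)"
  proof (rule choice_payoff_le[OF admissibleD(1)[OF adm]])
    show "AE x in ?pol N (cap (real T)) (offer True).
        payoff ?pol ennreal N (real T - weight True * x 0) (0 + reward True * x 0)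
          \<le> ennreal (1 + p * real N)"
      using myopic_accepts[OF assms wT, of N True]
    proof eventually_elim
      case (elim x)
      then show ?case
        using payoff_unblockable_le[OF adm, of "real T - 1" 1 N] T
        by (simp add: weight_def reward_def)
    qed
  qed
  moreover have "choice_payoff ?pol ennreal N (real T) 0 False \<le> ennreal eps"
  proof (rule choice_payoff_le[OF admissibleD(1)[OF adm]])
    show "AE x in ?pol N (cap (real T)) (offer False).
        payoff ?pol ennreal N (real T - weight False * x 0) (0 + reward False * x 0) \<le> ennreal eps"
      using myopic_accepts[OF assms wT, of N False]
    proof eventually_elim
      case (elim x)
      then show ?case
        using payoff_exhausted[OF adm, of eps N] eps by (simp add: weight_def reward_def)
    qed
  qed
  moreover have "p * (1 + p * real N) + (1 - p) * eps \<le> p * (1 + p * real T) + (1 - p) * eps"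
    using p N by simp
  ultimately have "payoff ?pol ennreal (Suc N) (real T) 0 \<le> ennreal (p * (1 + p * real T) + (1 - p) * eps)"
    using p eps by (intro payoff_Suc_le[OF admissibleD(1)[OF adm], of _ _ _ "1 + p * real N" eps]) auto
  then have "ennreal (expected_total_reward T 1 1 (cap (real T)) D ?pol)
      \<le> ennreal (p * (1 + p * real T) + (1 - p) * eps)"
    by (simp add: expected_total_reward_eq(1)[OF adm] N)
  then show ?thesis
    using p eps by (subst (asm) ennreal_le_iff) auto
qed

lemma myopic_reward_pos:
  assumes "exact_solver 1 1 sol"
  shows "0 < expected_total_reward T 1 1 (cap (real T)) D (myopic sol)"
proof -
  let ?pol = "myopic sol"
  note adm = admissible_myopic[OF assms]
  obtain N where N: "Suc N = T" using T by (cases T) auto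
  have wT: "weight g \<le> real T" for g using T by (simp add: weight_def)
  have "ennreal eps \<le> choice_payoff ?pol ennreal N (real T) 0 g" for g
  proof (rule choice_payoff_ge[OF admissibleD(1)[OF adm]])
    show "AE x in ?pol N (cap (real T)) (offer g).
        ennreal eps \<le> payoff ?pol ennreal N (real T - weight g * x 0) (0 + reward g * x 0)"
      using myopic_accepts[OF assms wT, of N g]
    proof eventually_elim
      case (elim x)
      have "ennreal eps \<le> ennreal (reward g)"
        using eps by (intro ennreal_leI) (simp add: reward_def)
      also have "\<dots> \<le> payoff ?pol ennreal N (real T - weight g) (reward g)"
        using wT[of g] reward_pos[of g] by (intro payoff_ge_current[OF adm]) auto
      finally show ?case using elim by simp
    qed
  qed
  from payoff_Suc_ge[OF admissibleD(1)[OF adm] this _ this, of eps]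
  have "ennreal eps \<le> payoff ?pol ennreal (Suc N) (real T) 0"
    using eps by (simp add: algebra_simps)
  then have "ennreal eps \<le> ennreal (expected_total_reward T 1 1 (cap (real T)) D ?pol)"
    by (simp add: expected_total_reward_eq(1)[OF adm] N)
  then show ?thesis using eps by (auto simp: ennreal_le_iff2)
qed

section \<open>Single-sample OSO\<close>

abbreviation samples :: "nat \<Rightarrow> (nat \<Rightarrow> item) measure" where
  "samples n \<equiv> \<Pi>\<^sub>M i\<in>{1..n}. D"

lemma prob_space_samples: "prob_space (samples n)"
  by (rule prob_space_PiM) (rule prob_space_D)

lemma AE_samples: "AE \<omega> in samples n. \<forall>i\<in>{1..n}. \<exists>g. looks_like (\<omega> i) g"
  by (subst AE_finite_all) (auto intro!: AE_PiM_component prob_space_D AE_D_looks_like)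

lemma emeasure_samples_no_filler:
  "emeasure (samples n) {\<omega> \<in> space (samples n). \<forall>i\<in>{1..n}. looks_like (\<omega> i) False} = ennreal ((1 - p) ^ n)"
proof -
  interpret prob_space D by (rule prob_space_D)
  interpret product_prob_space "\<lambda>_. D" "{1..n}" by unfold_locales
  let ?B = "{\<xi> \<in> space D. looks_like \<xi> False}"
  have B: "?B \<in> sets D"
    using looks_like_measurable[of False] by (simp add: sets_D space_D pred_def)
  have "{\<omega> \<in> space (samples n). \<forall>i\<in>{1..n}. looks_like (\<omega> i) False} = {1..n} \<rightarrow>\<^sub>E ?B"
    by (rule set_eqI) (simp add: space_PiM PiE_iff, blast)
  moreover have "emeasure D ?B = ennreal (1 - p)"
  proof -
    have "emeasure D ?B = (\<integral>\<^sup>+\<xi>. indicator ?B \<xi> \<partial>D)"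
      by (rule nn_integral_indicator[OF B, symmetric])
    also have "\<dots> = ennreal (1 - p)"
    proof (subst nn_integral_D)
      show "indicator ?B \<in> borel_measurable (item_space 1 1)"
        using B by (simp add: sets_D)
    qed (simp add: indicator_def space_D)
    finally show ?thesis .
  qed
  moreover have "emeasure (samples n) ({1..n} \<rightarrow>\<^sub>E ?B) = (\<Prod>i\<in>{1..n}. emeasure D ?B)"
    by (rule emeasure_PiM) (auto simp: B)
  moreover have "(\<Prod>i\<in>{1..n}. ennreal (1 - p)) = ennreal ((1 - p) ^ n)"
    using p by (simp add: ennreal_power del: ennreal_minus)
  ultimately show ?thesis by (simp only:)
qed

lemma oso_kernel_measurable:
  assumes "exact_solver 1 1 sol"
  shows "(\<lambda>\<omega>. measure_pmf (map_pmf (\<lambda>x. x 0) (sol (Suc n) (cap c) (fun_upd \<omega> 0 (offer g)))))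
    \<in> samples n \<rightarrow>\<^sub>M subprob_algebra (count_space UNIV)"
proof -
  have eq: "insert (0::nat) {1..n} = {..<Suc n}" by auto
  have "(\<lambda>\<omega>. fun_upd \<omega> 0 (offer g)) \<in> samples n \<rightarrow>\<^sub>M (\<Pi>\<^sub>M i\<in>{..<Suc n}. item_space 1 1)"
    by (rule measurable_fun_upd[where J = "{1..n}"])
       (use eq in \<open>auto simp: measurable_const intro!: measurable_ident_sets sets_PiM_cong sets_D\<close>)
  from measurable_compose[OF measurable_Pair[OF measurable_const[OF cap_in_space] this] solver_prob[OF assms]]
  show ?thesis by (intro measurable_prob_algebraD) simp
qed

lemma oso_instance_in_space:
  assumes "\<omega> \<in> space (samples n)"
  shows "fun_upd \<omega> 0 (offer g) \<in> {..<Suc n} \<rightarrow>\<^sub>E space (item_space 1 1)"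
  using assms by (auto simp: space_PiM space_D PiE_iff extensional_def)

text \<open>
  Reduces almost sure properties of a decision of OSO to properties of optimal solutions for lists
  of fillers and blockers. The list \<open>h\<close> of types is recovered from the samples, and position \<open>0\<close>
  holds the current item.
\<close>

lemma AE_oso_optimal:
  assumes sol: "exact_solver 1 1 sol" and c: "0 \<le> c"
    and P: "\<And>x I h. \<lbrakk>\<forall>i<Suc n. looks_like (I i) (h i); h 0 = g;
       x \<in> ip_optimal 1 1 (Suc n) (cap c) I\<rbrakk> \<Longrightarrow> P (x 0)"
  shows "AE x in single_sample_oso D sol n (cap c) (offer g). P x"
  unfolding single_sample_oso_def
proof (subst AE_bind[OF oso_kernel_measurable[OF sol]])
  show "AE \<omega> in samples n. AE x in measure_pmf (map_pmf (\<lambda>x. x 0) (sol (Suc n) (cap c) (fun_upd \<omega> 0 (offer g)))). P x"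
    using AE_samples[of n] AE_space
  proof eventually_elim
    case (elim \<omega>)
    let ?I = "fun_upd \<omega> 0 (offer g)"
    have "\<forall>i<Suc n. \<exists>h. looks_like (?I i) h"
      using elim(1) by auto
    then obtain h where h: "\<forall>i<Suc n. looks_like (?I i) (h i)" by metis
    then have "h 0 = g" by auto
    then have "P (x 0)" if "x \<in> set_pmf (sol (Suc n) (cap c) ?I)" for x
      using P[OF h _ solver_optimal[OF sol c oso_instance_in_space[OF elim(2)] that]] by simp
    then show ?case by (auto simp: AE_measure_pmf_iff)
  qed
qed simp

lemma admissible_oso:
  assumes "exact_solver 1 1 sol"
  shows "admissible (single_sample_oso D sol)"
  unfolding admissible_def
proof (intro conjI allI impI)
  show "measurable_policy 1 1 (single_sample_oso D sol)"
    by (rule measurable_policy_oso[OF prob_space_D sets_D assms])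
next
  fix n c g assume c: "0 \<le> (c::real)"
  show "AE x in single_sample_oso D sol n (cap c) (offer g). x 0 \<in> {0, 1} \<and> weight g * x 0 \<le> c"
  proof (rule AE_oso_optimal[OF assms c])
    fix x I h
    assume I: "\<forall>i<Suc n. looks_like (I i) (h i)" and h: "h 0 = g"
      and "x \<in> ip_optimal 1 1 (Suc n) (cap c) I"
    then have "x \<in> ip_feasible 1 1 (Suc n) (cap c) I"
      unfolding ip_optimal_eq by blast
    from ip_feasibleD[OF I this, of 0] show "x 0 0 \<in> {0, 1} \<and> weight g * x 0 0 \<le> c"
      using h by simp
  qed
qed

lemma oso_accepts_filler:
  assumes "exact_solver 1 1 sol" "real (Suc n) \<le> c" "c \<le> real T"
  shows "AE x in single_sample_oso D sol n (cap c) (offer True). x 0 = 1"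
proof (rule AE_oso_optimal[OF assms(1)])
  show "0 \<le> c" using assms(2) by linarith
  show "x 0 0 = 1"
    if "\<forall>i<Suc n. looks_like (I i) (h i)" "h 0 = True" "x \<in> ip_optimal 1 1 (Suc n) (cap c) I" for x I h
    using ip_optimal_with_filler[OF that(1) assms(2,3) _ _ that(3), of 0 0] that(2) by simp
qed

text \<open>
  A single filler among the samples makes OSO reject the blocker.
\<close>

lemma prob_oso_rejects_blocker:
  assumes sol: "exact_solver 1 1 sol" and c: "real (Suc n) \<le> c" "c \<le> real T"
  shows "ennreal (1 - (1 - p) ^ n) \<le> emeasure (single_sample_oso D sol n (cap c) (offer False)) {x. x 0 = 0}"
proof -
  let ?K = "\<lambda>\<omega>. measure_pmf (map_pmf (\<lambda>x. x 0) (sol (Suc n) (cap c) (fun_upd \<omega> 0 (offer False))))"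
  let ?N = "{\<omega> \<in> space (samples n). \<forall>i\<in>{1..n}. looks_like (\<omega> i) False}"
  let ?Z = "{x :: decision. x 0 = 0}"
  interpret S: prob_space "samples n" by (rule prob_space_samples)
  have N: "?N \<in> sets (samples n)" by measurable
  have c0: "0 \<le> c" using c(1) by linarith
  have "ennreal (1 - (1 - p) ^ n) = emeasure (samples n) (space (samples n) - ?N)"
    using p by (subst emeasure_compl[OF N])
      (simp_all add: emeasure_samples_no_filler S.emeasure_space_1 ennreal_minus flip: ennreal_1)
  also have "\<dots> = (\<integral>\<^sup>+\<omega>. indicator (space (samples n) - ?N) \<omega> \<partial>samples n)"
    using N by (intro nn_integral_indicator[symmetric]) auto
  also have "\<dots> \<le> (\<integral>\<^sup>+\<omega>. emeasure (?K \<omega>) ?Z \<partial>samples n)"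
  proof (rule nn_integral_mono_AE)
    show "AE \<omega> in samples n. indicator (space (samples n) - ?N) \<omega> \<le> emeasure (?K \<omega>) ?Z"
      using AE_samples[of n] AE_space
    proof eventually_elim
      case (elim \<omega>)
      show ?case
      proof (cases "\<omega> \<in> ?N")
        case False
        then obtain k where k: "k \<in> {1..n}" "\<not> looks_like (\<omega> k) False" using elim(2) by auto
        let ?I = "fun_upd \<omega> 0 (offer False)"
        have "\<forall>i<Suc n. \<exists>h. looks_like (?I i) h" using elim(1) by auto
        then obtain h where h: "\<forall>i<Suc n. looks_like (?I i) (h i)" by metis
        then have h0: "\<not> h 0" by auto
        have hk: "h k" using h[rule_format, of k] k by (cases "h k") auto
        have "x 0 0 = 0" if "x \<in> set_pmf (sol (Suc n) (cap c) ?I)" for x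
          using ip_optimal_with_filler[OF h c _ hk solver_optimal[OF sol c0 oso_instance_in_space[OF elim(2)] that], of 0] k h0
          by simp
        then have "AE x in ?K \<omega>. x \<in> ?Z" by (auto simp: AE_measure_pmf_iff)
        then have "emeasure (?K \<omega>) ?Z = 1"
          by (subst measure_pmf.emeasure_eq_1_AE) auto
        then show ?thesis by (simp add: indicator_def)
      qed simp
    qed
  qed
  also have "\<dots> = emeasure (samples n \<bind> ?K) ?Z"
    by (rule emeasure_bind[OF S.not_empty oso_kernel_measurable[OF sol], symmetric]) simp
  finally show ?thesis by (simp add: single_sample_oso_def)
qed

text \<open>
  Once a filler has been taken, no blocker fits, and there is room for all the remaining items; so
  OSO collects every later filler.
\<close>

lemma oso_payoff_unblockable_ge:
  assumes sol: "exact_solver 1 1 sol" and "real n \<le> c" "c < real T" "0 \<le> v"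
  shows "ennreal (v + p * real n) \<le> payoff (single_sample_oso D sol) ennreal n c v"
  using assms(2-4)
proof (induction n arbitrary: c v)
  case (Suc n)
  let ?pol = "single_sample_oso D sol"
  note adm = admissible_oso[OF sol]
  have c0: "0 \<le> c" using Suc.prems by simp
  have "ennreal (v + 1 + p * real n) \<le> choice_payoff ?pol ennreal n c v True"
  proof (rule choice_payoff_ge[OF admissibleD(1)[OF adm]])
    show "AE x in ?pol n (cap c) (offer True). ennreal (v + 1 + p * real n)
        \<le> payoff ?pol ennreal n (c - weight True * x 0) (v + reward True * x 0)"
      using oso_accepts_filler[OF sol Suc.prems(1) less_imp_le[OF Suc.prems(2)]]
    proof eventually_elim
      case (elim x)
      then show ?case
        using Suc.IH[of "c - 1" "v + 1"] Suc.prems by (simp add: weight_def reward_def)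
    qed
  qed
  moreover have "ennreal (v + p * real n) \<le> choice_payoff ?pol ennreal n c v False"
  proof (rule choice_payoff_ge[OF admissibleD(1)[OF adm]])
    show "AE x in ?pol n (cap c) (offer False). ennreal (v + p * real n)
        \<le> payoff ?pol ennreal n (c - weight False * x 0) (v + reward False * x 0)"
      using admissibleD(2)[OF adm c0, where n = n and g = False]
    proof eventually_elim
      case (elim x)
      then have "x 0 = 0" using Suc.prems by (auto simp: weight_def)
      then show ?case using Suc.IH[of c v] Suc.prems by simp
    qed
  qed
  moreover have "v + p * real (Suc n) \<le> p * (v + 1 + p * real n) + (1 - p) * (v + p * real n)"
    by (simp add: algebra_simps)
  ultimately show ?case
    using Suc.prems p by (intro payoff_Suc_ge[OF admissibleD(1)[OF adm]]) auto
qed (simp add: payoff_0)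

text \<open>
  By Bernoulli's inequality \<open>1 + p n \<le> (1 + p)^n\<close>, and \<open>(1 - p)(1 + p) \<le> 1\<close>.
\<close>

lemma geometric_times_linear_le_1: "(1 - p) ^ n * (p * real n) \<le> 1"
proof -
  have "(1 - p) ^ n * (p * real n) \<le> (1 - p) ^ n * (1 + p) ^ n"
    using Bernoulli_inequality[of p n] p by (intro mult_left_mono) (auto simp: mult.commute)
  also have "\<dots> = (1 - p\<^sup>2) ^ n"
    by (simp add: power_mult_distrib[symmetric] power2_eq_square algebra_simps)
  also have "\<dots> \<le> 1"
    using p by (intro power_le_one) (auto simp: power2_eq_square mult_le_one)
  finally show ?thesis .
qed

text \<open>
  While nothing has been accepted, OSO loses at most \<open>1 / p\<close> against the \<open>p n\<close> fillers expected
  among the remaining items. In the step, an accepted filler leads to the situation of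
  \<open>oso_payoff_unblockable_ge\<close>, which is the ideal one. A blocker is accepted with probability
  at most \<open>(1 - p)^n\<close>, and then the whole future reward, roughly \<open>p n\<close>, is lost; by
  \<open>geometric_times_linear_le_1\<close> this loss is at most \<open>1\<close> in expectation. It is compensated
  because the deficit \<open>1 / p\<close> is carried over only in the blocker case: \<open>1 / p\<close> exceeds
  \<open>(1 - p) / p\<close> by exactly \<open>1\<close>. For small \<open>n\<close> the bound \<open>p n - 1 / p\<close> is negative,
  and the maximum with \<open>0\<close> records that reward already collected is never lost.
\<close>

lemma oso_payoff_untouched_ge:
  assumes sol: "exact_solver 1 1 sol" and "n \<le> T" "0 \<le> v"
  shows "ennreal (v + max 0 (p * real n - 1 / p)) \<le> payoff (single_sample_oso D sol) ennreal n (real T) v"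
  using assms(2-3)
proof (induction n arbitrary: v)
  case (Suc n)
  let ?pol = "single_sample_oso D sol" and ?q = "(1 - p) ^ n"
  note adm = admissible_oso[OF sol]
  define L where "L = max 0 (p * real n - 1 / p)"
  have L: "0 \<le> L" "p * real n - 1 / p \<le> L" by (auto simp: L_def)
  have q: "0 \<le> ?q" "?q \<le> 1" using p by (auto intro: power_le_one)
  have n: "real (Suc n) \<le> real T" using Suc.prems by simp
  have "ennreal (v + 1 + p * real n) \<le> choice_payoff ?pol ennreal n (real T) v True"
  proof (rule choice_payoff_ge[OF admissibleD(1)[OF adm]])
    show "AE x in ?pol n (cap (real T)) (offer True). ennreal (v + 1 + p * real n)
        \<le> payoff ?pol ennreal n (real T - weight True * x 0) (v + reward True * x 0)"
      using oso_accepts_filler[OF sol n order_refl]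
    proof eventually_elim
      case (elim x)
      then show ?case
        using oso_payoff_unblockable_ge[OF sol, of n "real T - 1" "v + 1"] Suc.prems
        by (simp add: weight_def reward_def)
    qed
  qed
  moreover have "ennreal (v + L * (1 - ?q)) \<le> choice_payoff ?pol ennreal n (real T) v False"
  proof -
    let ?P = "?pol n (cap (real T)) (offer False)"
    interpret P: prob_space ?P by (rule prob_space_policy[OF admissibleD(1)[OF adm]])
    note sets_P = sets_policy[OF admissibleD(1)[OF adm], of n "real T" False]
    have meas: "f \<in> borel_measurable ?P" for f :: "decision \<Rightarrow> ennreal"
      by (rule measurableI) (auto simp: sets_P)
    have "ennreal (v + L * (1 - ?q)) = ennreal v + ennreal L * ennreal (1 - ?q)"
      using Suc.prems L q by (simp add: ennreal_mult ennreal_plus)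
    also have "\<dots> \<le> ennreal v + ennreal L * emeasure ?P {x. x 0 = 0}"
      by (intro add_left_mono mult_left_mono prob_oso_rejects_blocker[OF sol n]) auto
    also have "\<dots> = (\<integral>\<^sup>+x. ennreal v + ennreal L * indicator {x. x 0 = 0} x \<partial>?P)"
      by (subst nn_integral_add) (auto simp: meas nn_integral_cmult sets_P P.emeasure_space_1)
    also have "\<dots> \<le> choice_payoff ?pol ennreal n (real T) v False"
      unfolding choice_payoff_def
    proof (rule nn_integral_mono_AE)
      have T0: "0 \<le> real T" by simp
      show "AE x in ?P. ennreal v + ennreal L * indicator {x. x 0 = 0} x
          \<le> payoff ?pol ennreal n (real T - weight False * x 0) (v + reward False * x 0)"
        using admissibleD(2)[OF adm T0, where n = n and g = False]
      proof eventually_elim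
        case (elim x)
        show ?case
        proof (cases "x 0 = 0")
          case True
          then show ?thesis
            using Suc.IH[of v] Suc.prems L(1) by (simp add: L_def)
        next
          case False
          then have x: "x 0 = 1" using elim by auto
          have "ennreal v \<le> ennreal (v + eps)" using eps by (intro ennreal_leI) simp
          also have "\<dots> \<le> payoff ?pol ennreal n 0 (v + eps)"
            using eps Suc.prems by (intro payoff_ge_current[OF adm]) auto
          finally show ?thesis using x by (simp add: weight_def reward_def)
        qed
      qed
    qed
    finally show ?thesis .
  qed
  moreover have "v + max 0 (p * real (Suc n) - 1 / p) \<le> p * (v + 1 + p * real n) + (1 - p) * (v + L * (1 - ?q))"
  proof -
    have "(1 - p) * (1 - ?q) * (p * real n - 1 / p) \<le> (1 - p) * (1 - ?q) * L"
      using p q L by (intro mult_left_mono) auto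
    moreover have "(1 - p) * (1 - ?q) * (p * real n - 1 / p) =
        p * real n - p * (p * real n) - 1 / p + 1 + (1 - p) * (?q / p) - (1 - p) * (?q * (p * real n))"
      using p by (simp add: field_simps)
    moreover have "(1 - p) * (?q * (p * real n)) \<le> 1 - p"
      using geometric_times_linear_le_1[of n] p by (intro mult_left_le) auto
    moreover have "0 \<le> (1 - p) * (?q / p)" "0 \<le> (1 - p) * (1 - ?q) * L" "0 \<le> p * (p * real n)"
      using p q L by auto
    moreover have "p * (v + 1 + p * real n) + (1 - p) * (v + L * (1 - ?q)) =
        v + p + p * (p * real n) + (1 - p) * (1 - ?q) * L"
      by (simp add: algebra_simps)
    moreover have "p * real (Suc n) = p * real n + p"
      by (simp add: algebra_simps)
    ultimately show ?thesis using p by linarith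
  qed
  ultimately show ?case
    using Suc.prems L q p by (intro payoff_Suc_ge[OF admissibleD(1)[OF adm]]) auto
qed (use p in \<open>simp add: payoff_0\<close>)

lemma oso_reward_ge:
  assumes "exact_solver 1 1 sol"
  shows "p * real T - 1 / p \<le> expected_total_reward T 1 1 (cap (real T)) D (single_sample_oso D sol)"
proof -
  have "ennreal (p * real T - 1 / p) \<le> ennreal (0 + max 0 (p * real T - 1 / p))"
    by (intro ennreal_leI) simp
  also have "\<dots> \<le> ennreal (expected_total_reward T 1 1 (cap (real T)) D (single_sample_oso D sol))"
    unfolding expected_total_reward_eq(1)[OF admissible_oso[OF assms]]
    by (rule oso_payoff_untouched_ge[OF assms]) auto
  finally show ?thesis
    by (subst (asm) ennreal_le_iff) (auto simp: expected_total_reward_eq(2)[OF admissible_oso[OF assms]])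
qed

end

section \<open>Unbounded benefit over the myopic policy\<close>

theorem proposition1:
  fixes M :: real
  assumes "M > 0"
  shows "\<exists>T m d b D. allocation_instance T m d b D \<and>
           (\<forall>greedy sol.
              exact_solver m d greedy \<and> exact_solver m d sol \<and> equivariant_solver m d sol \<longrightarrow>
              0 < expected_total_reward T m d b D (myopic greedy) \<and>
              expected_total_reward T m d b D (single_sample_oso D sol)
                \<ge> M * expected_total_reward T m d b D (myopic greedy))"
proof -
  \<comment> \<open>\<open>T\<close> is chosen with \<open>p T = 2 + 2 / p\<close>. Then the myopic reward is at most \<open>p (4 + 2 / p)\<close>
    and that of OSO at least \<open>2 + 1 / p\<close>, so \<open>M p \<le> 1 / 2\<close> suffices.\<close>
  obtain K :: nat where K: "2 * M + 2 \<le> real K" using real_arch_simple by blast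
  define T where "T = 2 * K + 2 * K\<^sup>2"
  define p where "p = 1 / real K"
  have K2: "2 \<le> real K" using K assms by linarith
  interpret blocking_instance p p T
    using K2 by unfold_locales (auto simp: p_def T_def)
  have pK: "real K = 1 / p" by (simp add: p_def)
  have p0: "0 < p" "p < 1" by (fact p)+
  have "M * p \<le> 1 / 2" using K K2 by (simp add: p_def field_simps)
  have T: "p * real T = 2 + 2 / p"
    using p0 by (simp add: T_def pK power2_eq_square field_simps)
  have bound: "M * (p * (1 + p * real T) + (1 - p) * p) \<le> p * real T - 1 / p"
  proof -
    have "p * (1 + p * real T) + (1 - p) * p \<le> p * (4 + 2 / p)"
      using p0 unfolding T by (simp add: algebra_simps)
    then have "M * (p * (1 + p * real T) + (1 - p) * p) \<le> (M * p) * (4 + 2 / p)"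
      using assms by (simp add: mult_left_mono mult.assoc)
    also have "\<dots> \<le> 1 / 2 * (4 + 2 / p)"
      using \<open>M * p \<le> 1 / 2\<close> p0 by (intro mult_right_mono) auto
    also have "\<dots> = p * real T - 1 / p" unfolding T by simp
    finally show ?thesis .
  qed
  show ?thesis
  proof (intro exI conjI allI impI)
    show "allocation_instance T 1 1 (cap (real T)) D" by (rule allocation_instance_D)
    fix greedy sol
    assume sols: "exact_solver 1 1 greedy \<and> exact_solver 1 1 sol \<and> equivariant_solver 1 1 sol"
    show "0 < expected_total_reward T 1 1 (cap (real T)) D (myopic greedy)"
      using sols by (blast intro: myopic_reward_pos)
    have "M * expected_total_reward T 1 1 (cap (real T)) D (myopic greedy)
        \<le> M * (p * (1 + p * real T) + (1 - p) * p)"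
      using sols assms by (intro mult_left_mono myopic_reward_le) auto
    also have "\<dots> \<le> p * real T - 1 / p" by (rule bound)
    also have "\<dots> \<le> expected_total_reward T 1 1 (cap (real T)) D (single_sample_oso D sol)"
      using sols by (intro oso_reward_ge) auto
    finally show "M * expected_total_reward T 1 1 (cap (real T)) D (myopic greedy)
        \<le> expected_total_reward T 1 1 (cap (real T)) D (single_sample_oso D sol)" .
  qed
qed

end
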